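(* Let $K$ be a centrally symmetric convex body in $\mathbb{R}^n$. Then $$S(K)\geqslant\sqrt{n}\,|K|\,M(K).$$ In fact, $\inf\{p(K): K\text{ a centered convex body in }\mathbb{R}^n\}\approx\sqrt n$.
   Context: A convex body in $\mathbb{R}^n$ is a compact convex set with non-empty interior; it is centrally symmetric if $x\in K$ implies $-x\in K$, and centered if its barycenter $\frac1{|K|}\int_Kx\,dx$ is the origin. As usual $n\geqslant2$. $|\cdot|$ is volume, $S(K)$ is the surface area of $K$, $\sigma$ is the rotationally invariant probability measure on the unit sphere $S^{n-1}$. $\|x\|_K=\min\{t\geqslant0:x\in tK\}$ is the Minkowski functional of $K$, $M(K)=\int_{S^{n-1}}\|\xi\|_K\,d\sigma(\xi)$, and $p(K)=\frac{S(K)}{|K|M(K)}$. $a\approx b$ means that there are absolute constants $c_1,c_2>0$ (independent of $n$) with $c_1a\leqslant b\leqslant c_2a$. *)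

theory Defs
  imports "HOL-Probability.Probability"
begin

text \<open>
  The constants hidden in \<open>\<approx>\<close> must not depend on the dimension, so the dimension has to be a
  bound variable rather than a type. Hence \<open>\<real>\<^sup>n\<close> is the set of extensional functions
  \<open>{..<n} \<rightarrow>\<^sub>E UNIV\<close>, which is the carrier both of the library's product topology and of its
  product measure over the index set \<open>{..<n}\<close>.
\<close>

abbreviation Rn :: "nat \<Rightarrow> (nat \<Rightarrow> real) set" where
  "Rn n \<equiv> {..<n} \<rightarrow>\<^sub>E UNIV"

abbreviation Rn_top :: "nat \<Rightarrow> (nat \<Rightarrow> real) topology" where
  "Rn_top n \<equiv> product_topology (\<lambda>_. euclideanreal) {..<n}"

abbreviation Rn_leb :: "nat \<Rightarrow> (nat \<Rightarrow> real) measure" where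
  "Rn_leb n \<equiv> (\<Pi>\<^sub>M i\<in>{..<n}. lborel)"

definition vadd :: "nat \<Rightarrow> (nat \<Rightarrow> real) \<Rightarrow> (nat \<Rightarrow> real) \<Rightarrow> nat \<Rightarrow> real" where
  "vadd n x y = (\<lambda>i\<in>{..<n}. x i + y i)"

definition vscale :: "nat \<Rightarrow> real \<Rightarrow> (nat \<Rightarrow> real) \<Rightarrow> nat \<Rightarrow> real" where
  "vscale n a x = (\<lambda>i\<in>{..<n}. a * x i)"

definition vnorm :: "nat \<Rightarrow> (nat \<Rightarrow> real) \<Rightarrow> real" where
  "vnorm n x = L2_set x {..<n}"

definition unit_ball :: "nat \<Rightarrow> (nat \<Rightarrow> real) set" where
  "unit_ball n = {x \<in> Rn n. vnorm n x \<le> 1}"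

definition unit_sphere :: "nat \<Rightarrow> (nat \<Rightarrow> real) set" where
  "unit_sphere n = {x \<in> Rn n. vnorm n x = 1}"

definition convex_body :: "nat \<Rightarrow> (nat \<Rightarrow> real) set \<Rightarrow> bool" where
  "convex_body n K \<longleftrightarrow>
     compactin (Rn_top n) K \<and>
     (\<forall>x\<in>K. \<forall>y\<in>K. \<forall>u\<in>{0..1}. vadd n (vscale n (1 - u) x) (vscale n u y) \<in> K) \<and>
     Rn_top n interior_of K \<noteq> {}"

definition centrally_symmetric :: "nat \<Rightarrow> (nat \<Rightarrow> real) set \<Rightarrow> bool" where
  "centrally_symmetric n K \<longleftrightarrow> (\<forall>x\<in>K. vscale n (- 1) x \<in> K)"

definition vol :: "nat \<Rightarrow> (nat \<Rightarrow> real) set \<Rightarrow> real" where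
  "vol n K = measure (Rn_leb n) K"

definition barycenter :: "nat \<Rightarrow> (nat \<Rightarrow> real) set \<Rightarrow> nat \<Rightarrow> real" where
  "barycenter n K = (\<lambda>i\<in>{..<n}. (1 / vol n K) * (LINT x:K|Rn_leb n. x i))"

definition centered :: "nat \<Rightarrow> (nat \<Rightarrow> real) set \<Rightarrow> bool" where
  "centered n K \<longleftrightarrow> barycenter n K = (\<lambda>i\<in>{..<n}. 0)"

definition outer_parallel :: "nat \<Rightarrow> (nat \<Rightarrow> real) set \<Rightarrow> real \<Rightarrow> (nat \<Rightarrow> real) set" where
  "outer_parallel n K t = {vadd n x (vscale n t y) | x y. x \<in> K \<and> y \<in> unit_ball n}"

text \<open>
  Surface area as Minkowski content, the derivative at \<open>0\<close> from the right of the volume of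
  \<open>K + t B\<close>. The lower limit, as in the usual definition of Minkowski content, makes this
  total; for a convex body it is a finite limit.
\<close>

definition surface_area :: "nat \<Rightarrow> (nat \<Rightarrow> real) set \<Rightarrow> real" where
  "surface_area n K =
     real_of_ereal
       (Liminf (at_right 0) (\<lambda>t. ereal ((vol n (outer_parallel n K t) - vol n K) / t)))"

text \<open>
  If \<open>K\<close> is a convex body with \<open>0\<close> in its interior, the infimum is attained.
\<close>

definition minkowski_functional :: "nat \<Rightarrow> (nat \<Rightarrow> real) set \<Rightarrow> (nat \<Rightarrow> real) \<Rightarrow> real" where
  "minkowski_functional n K x = Inf {t. 0 \<le> t \<and> x \<in> vscale n t ` K}"

definition mat_apply :: "nat \<Rightarrow> (nat \<Rightarrow> nat \<Rightarrow> real) \<Rightarrow> (nat \<Rightarrow> real) \<Rightarrow> nat \<Rightarrow> real" where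
  "mat_apply n A x = (\<lambda>i\<in>{..<n}. \<Sum>j<n. A i j * x j)"

definition orthogonal_mat :: "nat \<Rightarrow> (nat \<Rightarrow> nat \<Rightarrow> real) \<Rightarrow> bool" where
  "orthogonal_mat n A \<longleftrightarrow>
     (\<forall>i<n. \<forall>j<n. (\<Sum>k<n. A k i * A k j) = (if i = j then 1 else 0))"

text \<open>
  The library has no surface measure on the sphere, so \<open>\<sigma>\<close> enters through its defining property:
  it is the (unique) Borel probability measure on the sphere invariant under the orthogonal group.
\<close>

definition rotation_invariant_prob :: "nat \<Rightarrow> (nat \<Rightarrow> real) measure \<Rightarrow> bool" where
  "rotation_invariant_prob n \<sigma> \<longleftrightarrow>
     prob_space \<sigma> \<and>
     sets \<sigma> = sets (restrict_space (Rn_leb n) (unit_sphere n)) \<and>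
     (\<forall>A. orthogonal_mat n A \<longrightarrow> distr \<sigma> \<sigma> (mat_apply n A) = \<sigma>)"

definition mean_norm :: "nat \<Rightarrow> (nat \<Rightarrow> real) measure \<Rightarrow> (nat \<Rightarrow> real) set \<Rightarrow> real" where
  "mean_norm n \<sigma> K = (LINT \<xi>|\<sigma>. minkowski_functional n K \<xi>)"

definition p_ratio :: "nat \<Rightarrow> (nat \<Rightarrow> real) measure \<Rightarrow> (nat \<Rightarrow> real) set \<Rightarrow> real" where
  "p_ratio n \<sigma> K = surface_area n K / (vol n K * mean_norm n \<sigma> K)"

end

theory Submission
  imports Defs
begin

text \<open>
  Both parts follow from one inequality, valid for every centered convex body \<open>K\<close> (a symmetric body
  is centered) and every \<open>t > 0\<close>:
  \<open>|K + t B| - |K| \<ge> t \<surd>n |K| M(K)\<close>. Dividing by \<open>t\<close> and passing to the lower limit gives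
  \<open>S(K) \<ge> \<surd>n |K| M(K)\<close>.

  Its source is a comparison of gauge and projection. Let \<open>P\<close> be the projection of \<open>K\<close> along a
  direction \<open>\<theta>\<close>. Then \<open>|K| \<parallel>\<theta>\<parallel>\<^sub>K \<le> 2 |P|\<close>. Indeed, push every point of \<open>K\<close> in direction \<open>\<theta>\<close> to
  the boundary. The mean of the resulting points lies in \<open>K\<close>, and since \<open>K\<close> is centered this mean is
  \<open>u \<theta>\<close>, where \<open>u\<close> is the average length of the push; so \<open>\<parallel>\<theta>\<parallel>\<^sub>K \<le> 1 / u\<close>. On the other hand
  \<open>u |K| = \<integral> |K \<inter> (K - s \<theta>)| ds\<close> over \<open>s \<ge> 0\<close>, and \<open>|K \<inter> (K - s \<theta>)| \<ge> |K| - s |P|\<close>, which gives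
  \<open>u \<ge> |K| / (2 |P|)\<close>. Projections enter only through volumes: for convex \<open>K\<close>, adding the
  segment \<open>[0, s \<theta>]\<close> to \<open>K\<close> increases the volume by \<open>s |P|\<close>. This increment, called \<open>growth\<close>, is
  additive in \<open>s\<close> by translation invariance of volume, and it is monotone in \<open>K\<close>. The comparison is
  \<open>minkowski_functional_growth\<close>.

  Adding several segments \<open>[0, \<theta>\<^sub>j]\<close> one after the other, monotonicity shows that the volume increases
  by at least the sum of the growths of \<open>K\<close> itself, hence by at least
  \<open>(|K| / 2) \<Sum> \<parallel>\<theta>\<^sub>j\<parallel>\<^sub>K\<close> (\<open>zonotope_growth\<close>). The vectors are chosen as a discretisation of
  \<open>2 t \<surd>n \<xi> d\<sigma>(\<xi>)\<close>: then half their sum of gauges is about \<open>t \<surd>n M(K)\<close>, while the zonotope that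
  they span is, up to translation, nearly contained in \<open>t B\<close>, because its support function is about
  \<open>t \<surd>n \<integral> |\<langle>\<xi>, y\<rangle>| d\<sigma>(\<xi>) \<le> t |y|\<close>, by Cauchy-Schwarz and
  \<open>\<integral> \<xi>\<^sub>i \<xi>\<^sub>j d\<sigma> = \<delta>\<^sub>i\<^sub>j / n\<close>. Refining the discretisation gives the inequality (\<open>parallel_volume_growth\<close>).

  That the infimum is of order \<open>\<surd>n\<close> is shown by the slab \<open>[-1,1] \<times> [-n,n]\<^sup>n\<^sup>-\<^sup>1\<close>. Its surface area is
  at most \<open>4 |K|\<close>, its gauge is at least \<open>|\<xi>\<^sub>0|\<close>, and \<open>\<integral> |\<xi>\<^sub>0| d\<sigma> \<ge> 5 / (9 \<surd>n)\<close> follows from the second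
  and fourth moments of \<open>\<sigma>\<close>.
\<close>

section \<open>Grid approximation and compact sets in coordinates\<close>

lemma tendsto_const_over_Suc: "(\<lambda>k. c / real (Suc k)) \<longlonglongrightarrow> 0"
  using tendsto_mult[OF tendsto_const LIMSEQ_inverse_real_of_nat, of c] by (simp add: divide_inverse)

text \<open>
  Rounding each coordinate down to a multiple of \<open>1 / (k + 1)\<close>. On a bounded set it takes finitely many
  values, so it reduces integrals of points and gauges to finite sums.
\<close>

definition grid :: "nat \<Rightarrow> nat \<Rightarrow> (nat \<Rightarrow> real) \<Rightarrow> nat \<Rightarrow> real" where
  "grid n k x = (\<lambda>i\<in>{..<n}. real_of_int \<lfloor>real (Suc k) * x i\<rfloor> / real (Suc k))"

lemma grid_near:
  assumes "i < n"
  shows "\<bar>grid n k x i - x i\<bar> \<le> 1 / real (Suc k)"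
proof -
  have "\<bar>real_of_int \<lfloor>real (Suc k) * x i\<rfloor> - real (Suc k) * x i\<bar> \<le> 1"
    by linarith
  moreover have "grid n k x i - x i = (real_of_int \<lfloor>real (Suc k) * x i\<rfloor> - real (Suc k) * x i) / real (Suc k)"
    using assms by (simp add: grid_def field_simps)
  ultimately show ?thesis
    by (simp add: divide_right_mono)
qed

lemma grid_in_Rn: "grid n k x \<in> Rn n"
  by (simp add: grid_def)

lemma finite_grid_image:
  assumes "\<And>x i. x \<in> A \<Longrightarrow> i < n \<Longrightarrow> \<bar>x i\<bar> \<le> R"
  shows "finite (grid n k ` A)"
proof -
  define F where "F = (\<lambda>z. real_of_int z / real (Suc k)) ` {\<lfloor>- (real (Suc k) * R)\<rfloor>..\<lfloor>real (Suc k) * R\<rfloor>}"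
  have "grid n k x \<in> {..<n} \<rightarrow>\<^sub>E F" if "x \<in> A" for x
  proof -
    have "\<lfloor>real (Suc k) * x i\<rfloor> \<in> {\<lfloor>- (real (Suc k) * R)\<rfloor>..\<lfloor>real (Suc k) * R\<rfloor>}" if "i < n" for i
    proof -
      have "- R \<le> x i" "x i \<le> R"
        using assms[OF \<open>x \<in> A\<close> that] by auto
      then have "real (Suc k) * (- R) \<le> real (Suc k) * x i" "real (Suc k) * x i \<le> real (Suc k) * R"
        by (intro mult_left_mono; simp)+
      then show ?thesis
        by (auto intro!: floor_mono)
    qed
    then show ?thesis
      by (auto simp: grid_def F_def)
  qed
  then have "grid n k ` A \<subseteq> {..<n} \<rightarrow>\<^sub>E F"
    by blast
  moreover have "finite ({..<n} \<rightarrow>\<^sub>E F)"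
    by (intro finite_PiE) (simp_all add: F_def)
  ultimately show ?thesis
    by (rule finite_subset)
qed

lemma measurable_coordinate [measurable]:
  "i < n \<Longrightarrow> (\<lambda>x. x i) \<in> borel_measurable (Rn_leb n)"
  using measurable_component_singleton[of i "{..<n}" "\<lambda>_. lborel :: real measure"]
  by (simp add: measurable_lborel1)

lemma measurable_grid_cell:
  assumes "\<And>i. i < n \<Longrightarrow> (\<lambda>\<omega>. X \<omega> i) \<in> borel_measurable M" "v \<in> Rn n"
  shows "{\<omega> \<in> space M. grid n k (X \<omega>) = v} \<in> sets M"
proof -
  have "{\<omega> \<in> space M. grid n k (X \<omega>) = v}
      = {\<omega> \<in> space M. \<forall>i\<in>{..<n}. real_of_int \<lfloor>real (Suc k) * X \<omega> i\<rfloor> / real (Suc k) = v i}"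
    using assms(2) by (auto simp: grid_def fun_eq_iff PiE_def extensional_def)
  also have "\<dots> \<in> sets M"
    using assms(1) by (intro sets.sets_Collect_finite_All' sets.sets_Collect_finite_All) (auto intro!: measurable_sets) 
  finally show ?thesis .
qed

lemma compactin_subset_Rn: "compactin (Rn_top n) K \<Longrightarrow> K \<subseteq> Rn n"
  using compactin_subset_topspace by fastforce

lemma compactin_bounded:
  assumes "compactin (Rn_top n) K"
  obtains R where "R > 0" "\<And>x i. x \<in> K \<Longrightarrow> i < n \<Longrightarrow> \<bar>x i\<bar> \<le> R"
proof -
  have "\<exists>r. \<forall>x\<in>K. \<bar>x i\<bar> \<le> r" if "i < n" for i
  proof -
    have "continuous_map (Rn_top n) euclideanreal (\<lambda>x. x i)"
      using that by (intro continuous_map_product_projection) simp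
    then have "compactin euclideanreal ((\<lambda>x. x i) ` K)"
      using assms image_compactin by blast
    then have "bounded ((\<lambda>x. x i) ` K)"
      by (simp add: compact_imp_bounded)
    then show ?thesis
      by (auto simp: bounded_iff)
  qed
  then obtain r where r: "\<And>i x. i < n \<Longrightarrow> x \<in> K \<Longrightarrow> \<bar>x i\<bar> \<le> r i"
    by metis
  show thesis
  proof (rule that[of "1 + (\<Sum>i<n. \<bar>r i\<bar>)"])
    show "1 + (\<Sum>i<n. \<bar>r i\<bar>) > 0"
      by (simp add: add_pos_nonneg sum_nonneg)
    fix x i assume "x \<in> K" "i < n"
    then have "\<bar>x i\<bar> \<le> \<bar>r i\<bar>"
      using r by fastforce
    also have "\<dots> \<le> (\<Sum>i<n. \<bar>r i\<bar>)"
      using \<open>i < n\<close> by (intro member_le_sum) auto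
    finally show "\<bar>x i\<bar> \<le> 1 + (\<Sum>i<n. \<bar>r i\<bar>)" by simp
  qed
qed

text \<open>
  A compact set is closed in the product topology, where convergence is coordinatewise; this is the form
  in which closedness is used throughout.
\<close>

lemma compactin_limit:
  assumes K: "compactin (Rn_top n) K" and y: "\<And>k. y k \<in> K" and x: "x \<in> Rn n"
    and lim: "\<And>i. i < n \<Longrightarrow> (\<lambda>k. y k i) \<longlonglongrightarrow> x i"
  shows "x \<in> K"
proof -
  have "closedin (Rn_top n) K"
    using K by (intro compactin_imp_closedin) (simp add: Hausdorff_space_product_topology)
  moreover have "limitin (Rn_top n) y x sequentially"
    using x lim y compactin_subset_Rn[OF K]
    by (auto simp: limitin_componentwise PiE_iff subset_iff intro!: always_eventually)
  ultimately show ?thesis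
    using y by (auto elim!: limitin_closedin)
qed

lemma grid_limit:
  assumes "\<And>k. grid n k (y k) = grid n k (x k)" "(\<lambda>k. x k i) \<longlonglongrightarrow> l" "i < n"
  shows "(\<lambda>k. y k i) \<longlonglongrightarrow> l"
proof -
  have lim: "(\<lambda>k. 2 / real (Suc k)) \<longlonglongrightarrow> 0"
    by (rule tendsto_const_over_Suc)
  have "norm (y k i - x k i) \<le> 2 / real (Suc k)" for k
  proof -
    have "\<bar>y k i - x k i\<bar> \<le> 1 / real (Suc k) + 1 / real (Suc k)"
      using grid_near[OF assms(3), of k "y k", unfolded assms(1)] grid_near[OF assms(3), of k "x k"]
      by linarith
    then show ?thesis by simp
  qed
  then have "(\<lambda>k. y k i - x k i) \<longlonglongrightarrow> 0"
    using lim by (rule Lim_null_comparison[OF always_eventually[OF allI]])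
  from tendsto_add[OF this assms(2)] show ?thesis by simp
qed

text \<open>
  The \<open>\<sigma>\<close>-algebra is that of the product measure, so measurability of a compact set has to be derived:
  the set is the intersection over \<open>k\<close> of the union of those grid cells that meet it.
\<close>

lemma compactin_measurable:
  assumes K: "compactin (Rn_top n) K"
  shows "K \<in> sets (Rn_leb n)"
proof -
  obtain R where R: "\<And>x i. x \<in> K \<Longrightarrow> i < n \<Longrightarrow> \<bar>x i\<bar> \<le> R"
    using compactin_bounded[OF K] by metis
  define C where "C k = (\<Union>v\<in>grid n k ` K. {x \<in> space (Rn_leb n). grid n k x = v})" for k
  have "v \<in> Rn n" if "v \<in> grid n k ` K" for v k
    using that grid_in_Rn by blast
  then have "C k \<in> sets (Rn_leb n)" for k
    unfolding C_def by (intro sets.finite_UN finite_grid_image[of K n R] measurable_grid_cell R measurable_coordinate)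
  moreover have "K = (\<Inter>k. C k)"
  proof
    show "K \<subseteq> (\<Inter>k. C k)"
      using compactin_subset_Rn[OF K] by (auto simp: C_def space_PiM)
    show "(\<Inter>k. C k) \<subseteq> K"
    proof
      fix x assume x: "x \<in> (\<Inter>k. C k)"
      then have "\<forall>k. \<exists>y\<in>K. grid n k y = grid n k x"
        by (auto simp: C_def) metis
      then obtain y where y: "\<And>k. y k \<in> K" "\<And>k. grid n k (y k) = grid n k x"
        by metis
      moreover have "x \<in> Rn n"
        using x by (auto simp: C_def space_PiM)
      ultimately show "x \<in> K"
        using grid_limit[of n y "\<lambda>_. x"] by (intro compactin_limit[OF K, of y x]) auto
    qed
  qed
  ultimately show ?thesis by auto
qed

interpretation lborel_product: product_sigma_finite "\<lambda>_::nat. lborel :: real measure"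
  by standard

lemma emeasure_box:
  assumes "\<And>i. i < n \<Longrightarrow> a i \<le> b i"
  shows "emeasure (Rn_leb n) (\<Pi>\<^sub>E i\<in>{..<n}. {a i..b i}) = ennreal (\<Prod>i<n. b i - a i)"
proof -
  have "emeasure (Rn_leb n) (\<Pi>\<^sub>E i\<in>{..<n}. {a i..b i}) = (\<Prod>i<n. emeasure lborel {a i..b i})"
    by (intro lborel_product.emeasure_PiM) auto
  also have "\<dots> = (\<Prod>i<n. ennreal (b i - a i))"
    using assms by (intro prod.cong) auto
  also have "\<dots> = ennreal (\<Prod>i<n. b i - a i)"
    using assms by (intro prod_ennreal) auto
  finally show ?thesis .
qed

lemma vol_box:
  assumes "\<And>i. i < n \<Longrightarrow> a i \<le> b i"
  shows "vol n (\<Pi>\<^sub>E i\<in>{..<n}. {a i..b i}) = (\<Prod>i<n. b i - a i)"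
proof -
  have "0 \<le> (\<Prod>i<n. b i - a i)" using assms by (intro prod_nonneg) auto
  then show ?thesis
    by (simp add: vol_def measure_def emeasure_box[OF assms])
qed

lemma compactin_finite_measure:
  assumes K: "compactin (Rn_top n) K"
  shows "emeasure (Rn_leb n) K < \<infinity>"
proof -
  obtain R where R: "R > 0" "\<And>x i. x \<in> K \<Longrightarrow> i < n \<Longrightarrow> \<bar>x i\<bar> \<le> R"
    using compactin_bounded[OF K] by metis
  have "K \<subseteq> (\<Pi>\<^sub>E i\<in>{..<n}. {-R..R})"
  proof
    fix x assume x: "x \<in> K"
    have "x i \<in> {-R..R}" if "i < n" for i
      using R(2)[OF x that] by (simp add: abs_le_iff)
    with x compactin_subset_Rn[OF K] show "x \<in> (\<Pi>\<^sub>E i\<in>{..<n}. {-R..R})"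
      by (auto simp: PiE_iff)
  qed
  then have "emeasure (Rn_leb n) K \<le> emeasure (Rn_leb n) (\<Pi>\<^sub>E i\<in>{..<n}. {-R..R})"
    by (intro emeasure_mono sets_PiM_I_finite) auto
  also have "\<dots> < \<infinity>"
    using R(1) by (subst emeasure_box) auto
  finally show ?thesis .
qed

lemma vol_mono:
  assumes "compactin (Rn_top n) L" "K \<subseteq> L" "K \<in> sets (Rn_leb n)"
  shows "vol n K \<le> vol n L"
  using assms compactin_measurable[OF assms(1)] compactin_finite_measure[OF assms(1)]
  unfolding vol_def by (intro measure_mono_fmeasurable) (auto simp: fmeasurable_def)

lemma continuous_map_into_Rn:
  "continuous_map X (Rn_top n) (\<lambda>x. \<lambda>i\<in>{..<n}. f x i)
    \<longleftrightarrow> (\<forall>i<n. continuous_map X euclideanreal (\<lambda>x. f x i))"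
proof -
  have "continuous_map X euclideanreal (\<lambda>x. (\<lambda>i\<in>{..<n}. f x i) k) \<longleftrightarrow> continuous_map X euclideanreal (\<lambda>x. f x k)"
    if "k < n" for k
    using that by simp
  then show ?thesis
    by (auto simp: continuous_map_componentwise)
qed

lemma continuous_map_coordinate:
  "continuous_map X (Rn_top n) f \<Longrightarrow> i < n \<Longrightarrow> continuous_map X euclideanreal (\<lambda>x. f x i)"
  by (simp add: continuous_map_componentwise)

lemma compactin_minkowski_sum:
  assumes K: "compactin (Rn_top n) K" and L: "compactin (Rn_top n) L"
  shows "compactin (Rn_top n) {vadd n x y | x y. x \<in> K \<and> y \<in> L}"
proof -
  have "compactin (prod_topology (Rn_top n) (Rn_top n)) (K \<times> L)"
    using K L by (simp add: compactin_Times)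
  moreover have "continuous_map (prod_topology (Rn_top n) (Rn_top n)) (Rn_top n) (\<lambda>z. vadd n (fst z) (snd z))"
    unfolding vadd_def continuous_map_into_Rn
    by (intro allI impI continuous_map_add)
       (simp_all add: continuous_map_coordinate[OF continuous_map_fst] continuous_map_coordinate[OF continuous_map_snd])
  ultimately have "compactin (Rn_top n) ((\<lambda>z. vadd n (fst z) (snd z)) ` (K \<times> L))"
    by (rule image_compactin)
  also have "(\<lambda>z. vadd n (fst z) (snd z)) ` (K \<times> L) = {vadd n x y | x y. x \<in> K \<and> y \<in> L}"
    by force
  finally show ?thesis .
qed

lemma compactin_vscale:
  assumes K: "compactin (Rn_top n) K"
  shows "compactin (Rn_top n) (vscale n c ` K)"
proof (rule image_compactin[OF K])
  show "continuous_map (Rn_top n) (Rn_top n) (vscale n c)"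
    unfolding vscale_def[abs_def] continuous_map_into_Rn
    by (intro allI impI continuous_map_real_mult_left continuous_map_product_projection) simp
qed

lemma compactin_segment:
  fixes s :: real
  shows "compactin (Rn_top n) ((\<lambda>r. vscale n r \<theta>) ` {0..s})"
  by (rule image_compactin[where X = euclideanreal])
     (auto simp: vscale_def continuous_map_into_Rn intro!: continuous_intros)

lemma compactin_unit_ball: "compactin (Rn_top n) (unit_ball n)"
proof -
  have eq: "unit_ball n = (\<Pi>\<^sub>E i\<in>{..<n}. {-1..1}) \<inter> {x \<in> topspace (Rn_top n). (\<Sum>i<n. (x i)\<^sup>2) \<in> {..1}}"
  proof -
    have "\<bar>x i\<bar> \<le> 1" if "(\<Sum>i<n. (x i)\<^sup>2) \<le> 1" "i < n" for x :: "nat \<Rightarrow> real" and i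
    proof -
      have "(x i)\<^sup>2 \<le> (\<Sum>i<n. (x i)\<^sup>2)"
        using that(2) by (intro member_le_sum[of i "{..<n}" "\<lambda>i. (x i)\<^sup>2"]) auto
      with that(1) show ?thesis
        using abs_square_le_1[of "x i"] by linarith
    qed
    then show ?thesis
      by (auto simp: unit_ball_def vnorm_def L2_set_def PiE_iff abs_le_iff minus_le_iff extensional_def)
  qed
  have "compactin (Rn_top n) (\<Pi>\<^sub>E i\<in>{..<n}. {-1..1})"
    by (auto simp: compactin_PiE)
  moreover have "closedin (Rn_top n) {x \<in> topspace (Rn_top n). (\<Sum>i<n. (x i)\<^sup>2) \<in> {..1}}"
    by (rule closedin_continuous_map_preimage[where Y = euclideanreal])
       (auto intro!: continuous_map_sum continuous_map_real_pow continuous_map_product_projection)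
  ultimately show ?thesis
    unfolding eq by (rule compact_Int_closedin)
qed

lemma compactin_outer_parallel:
  assumes "compactin (Rn_top n) K"
  shows "compactin (Rn_top n) (outer_parallel n K t)"
proof -
  have "outer_parallel n K t = {vadd n x y | x y. x \<in> K \<and> y \<in> vscale n t ` unit_ball n}"
    by (auto simp: outer_parallel_def)
  then show ?thesis
    using compactin_minkowski_sum[OF assms compactin_vscale[OF compactin_unit_ball]] by simp
qed

section \<open>Affine maps and volume\<close>

lemma measurable_affine [measurable]:
  "(\<lambda>x. \<lambda>i\<in>{..<n}. a * x i + c i) \<in> measurable (Rn_leb n) (Rn_leb n)"
  by (rule measurable_restrict) (simp add: measurable_coordinate)

text \<open>
  Both sides agree on boxes, where the claim is the one-dimensional affine change of variables in every
  coordinate.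
\<close>

lemma Rn_leb_affine:
  assumes a: "a \<noteq> 0"
  shows "Rn_leb n = scale_measure (ennreal (\<bar>a\<bar> ^ n)) (distr (Rn_leb n) (Rn_leb n) (\<lambda>x. \<lambda>i\<in>{..<n}. a * x i + c i))"
    (is "_ = scale_measure _ (distr _ _ ?T)")
proof (rule sym, rule lborel_product.PiM_eqI)
  fix A :: "nat \<Rightarrow> real set" assume A: "\<And>i. i \<in> {..<n} \<Longrightarrow> A i \<in> sets lborel"
  have 1: "emeasure lborel (A i) = ennreal \<bar>a\<bar> * emeasure lborel ((\<lambda>x. c i + a * x) -` A i)" if "i < n" for i
  proof -
    have Ai: "A i \<in> sets borel" using A that by simp
    have "emeasure lborel (A i) = emeasure (density (distr lborel borel (\<lambda>x. c i + a * x)) (\<lambda>_. ennreal \<bar>a\<bar>)) (A i)"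
      using lborel_real_affine[OF a, of "c i"] by simp
    also have "\<dots> = ennreal \<bar>a\<bar> * emeasure (distr lborel borel (\<lambda>x. c i + a * x)) (A i)"
      using Ai by (simp add: emeasure_density_const)
    also have "emeasure (distr lborel borel (\<lambda>x. c i + a * x)) (A i) = emeasure lborel ((\<lambda>x. c i + a * x) -` A i)"
      using Ai by (subst emeasure_distr) auto
    finally show ?thesis .
  qed
  have pre: "(\<lambda>x. c i + a * x) -` A i \<in> sets lborel" if "i < n" for i
    using measurable_sets[of "\<lambda>x. c i + a * x" borel borel "A i"] A that by simp
  have "emeasure (scale_measure (ennreal (\<bar>a\<bar> ^ n)) (distr (Rn_leb n) (Rn_leb n) ?T)) (Pi\<^sub>E {..<n} A)
      = ennreal (\<bar>a\<bar> ^ n) * emeasure (Rn_leb n) (?T -` (Pi\<^sub>E {..<n} A) \<inter> space (Rn_leb n))"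
    using A by (subst emeasure_scale_measure, subst emeasure_distr) (auto intro!: sets_PiM_I_finite)
  also have "?T -` (Pi\<^sub>E {..<n} A) \<inter> space (Rn_leb n) = (\<Pi>\<^sub>E i\<in>{..<n}. (\<lambda>x. c i + a * x) -` A i)"
    by (auto simp: space_PiM PiE_iff add.commute)
  also have "emeasure (Rn_leb n) \<dots> = (\<Prod>i<n. emeasure lborel ((\<lambda>x. c i + a * x) -` A i))"
    using pre by (intro lborel_product.emeasure_PiM) auto
  also have "ennreal (\<bar>a\<bar> ^ n) * \<dots> = (\<Prod>i<n. ennreal \<bar>a\<bar> * emeasure lborel ((\<lambda>x. c i + a * x) -` A i))"
    by (simp add: prod.distrib ennreal_power)
  also have "\<dots> = (\<Prod>i<n. emeasure lborel (A i))"
    by (intro prod.cong refl) (simp add: 1)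
  finally show "emeasure (scale_measure (ennreal (\<bar>a\<bar> ^ n)) (distr (Rn_leb n) (Rn_leb n) ?T)) (Pi\<^sub>E {..<n} A)
      = (\<Prod>i\<in>{..<n}. emeasure lborel (A i))" .
qed auto

text \<open>
  The case \<open>a = 1\<close> is translation invariance, \<open>a > 0\<close> is homogeneity of volume, and \<open>a = -1\<close> is the
  reflection that makes symmetric bodies centered.
\<close>

lemma vol_affine:
  assumes "a \<noteq> 0" "A \<in> sets (Rn_leb n)"
  shows "vol n A = \<bar>a\<bar> ^ n * vol n {x \<in> Rn n. (\<lambda>i\<in>{..<n}. a * x i + c i) \<in> A}"
proof -
  let ?T = "\<lambda>x. \<lambda>i\<in>{..<n}. a * x i + c i"
  have "vol n A = measure (scale_measure (ennreal (\<bar>a\<bar> ^ n)) (distr (Rn_leb n) (Rn_leb n) ?T)) A"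
    unfolding vol_def using Rn_leb_affine[OF assms(1), of n c] by simp
  also have "\<dots> = \<bar>a\<bar> ^ n * measure (distr (Rn_leb n) (Rn_leb n) ?T) A"
    by (simp add: measure_scale_measure)
  also have "measure (distr (Rn_leb n) (Rn_leb n) ?T) A = vol n (?T -` A \<inter> space (Rn_leb n))"
    unfolding vol_def using assms(2) by (subst measure_distr) auto
  also have "?T -` A \<inter> space (Rn_leb n) = {x \<in> Rn n. ?T x \<in> A}"
    by (auto simp: space_PiM)
  finally show ?thesis .
qed

section \<open>Sweeping a convex set along a segment\<close>

definition slide :: "nat \<Rightarrow> (nat \<Rightarrow> real) \<Rightarrow> real \<Rightarrow> (nat \<Rightarrow> real) \<Rightarrow> nat \<Rightarrow> real" where
  "slide n x s \<theta> = (\<lambda>i\<in>{..<n}. x i + s * \<theta> i)"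

lemma slide_in_Rn: "slide n x s \<theta> \<in> Rn n"
  by (simp add: slide_def)

lemma slide_0: "x \<in> Rn n \<Longrightarrow> slide n x 0 \<theta> = x"
  by (auto simp: slide_def PiE_iff extensional_def)

lemma slide_slide: "slide n (slide n x s \<theta>) r \<theta> = slide n x (s + r) \<theta>"
  by (auto simp: slide_def algebra_simps)

lemma vol_slide:
  assumes "A \<in> sets (Rn_leb n)"
  shows "vol n {x \<in> Rn n. slide n x s \<theta> \<in> A} = vol n A"
  using vol_affine[of 1 A n "\<lambda>i. s * \<theta> i"] assms by (simp add: slide_def)

lemma measurable_slide [measurable]:
  "(\<lambda>x. slide n x s \<theta>) \<in> measurable (Rn_leb n) (Rn_leb n)"
  using measurable_affine[of 1 "\<lambda>i. s * \<theta> i" n] by (simp add: slide_def)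

definition convex_in :: "nat \<Rightarrow> (nat \<Rightarrow> real) set \<Rightarrow> bool" where
  "convex_in n K \<longleftrightarrow> (\<forall>x\<in>K. \<forall>y\<in>K. \<forall>u\<in>{0..1}. vadd n (vscale n (1 - u) x) (vscale n u y) \<in> K)"

lemma convex_inD:
  assumes "convex_in n K" "x \<in> K" "y \<in> K" "0 \<le> u" "u \<le> 1"
  shows "(\<lambda>i\<in>{..<n}. (1 - u) * x i + u * y i) \<in> K"
proof -
  have "vadd n (vscale n (1 - u) x) (vscale n u y) = (\<lambda>i\<in>{..<n}. (1 - u) * x i + u * y i)"
    by (auto simp: vadd_def vscale_def)
  then show ?thesis
    using assms unfolding convex_in_def by (metis atLeastAtMost_iff)
qed

lemma slide_between:
  assumes K: "convex_in n K" and "slide n x p \<theta> \<in> K" "slide n x q \<theta> \<in> K" "p \<le> r" "r \<le> q"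
  shows "slide n x r \<theta> \<in> K"
proof (cases "p = q")
  case True
  then show ?thesis using assms by simp
next
  case False
  define u where "u = (r - p) / (q - p)"
  have u: "0 \<le> u" "u \<le> 1" "r = (1 - u) * p + u * q"
    using assms(4,5) False by (auto simp: u_def divide_simps) (simp add: algebra_simps)
  have "slide n x r \<theta> = (\<lambda>i\<in>{..<n}. (1 - u) * slide n x p \<theta> i + u * slide n x q \<theta> i)"
    unfolding u(3) by (auto simp: slide_def algebra_simps)
  then show ?thesis
    using convex_inD[OF K assms(2,3) u(1,2)] by simp
qed

text \<open>
  The Minkowski sum of \<open>K\<close> and the segment \<open>[0, s \<theta>]\<close>.
\<close>

definition sweep :: "nat \<Rightarrow> (nat \<Rightarrow> real) set \<Rightarrow> (nat \<Rightarrow> real) \<Rightarrow> real \<Rightarrow> (nat \<Rightarrow> real) set" where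
  "sweep n K \<theta> s = {slide n x r \<theta> | x r. x \<in> K \<and> 0 \<le> r \<and> r \<le> s}"

lemma sweepI: "x \<in> K \<Longrightarrow> 0 \<le> r \<Longrightarrow> r \<le> s \<Longrightarrow> slide n x r \<theta> \<in> sweep n K \<theta> s"
  by (auto simp: sweep_def)

lemma sweepE:
  assumes "z \<in> sweep n K \<theta> s"
  obtains x r where "z = slide n x r \<theta>" "x \<in> K" "0 \<le> r" "r \<le> s"
  using assms by (auto simp: sweep_def)

lemma sweep_mono: "K \<subseteq> L \<Longrightarrow> r \<le> s \<Longrightarrow> sweep n K \<theta> r \<subseteq> sweep n L \<theta> s"
  unfolding sweep_def by force

lemma compactin_sweep:
  assumes K: "compactin (Rn_top n) K"
  shows "compactin (Rn_top n) (sweep n K \<theta> s)"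
proof -
  have "slide n x r \<theta> = vadd n x (vscale n r \<theta>)" for x r
    by (auto simp: slide_def vadd_def vscale_def)
  then have "sweep n K \<theta> s = {vadd n x y | x y. x \<in> K \<and> y \<in> (\<lambda>r. vscale n r \<theta>) ` {0..s}}"
    unfolding sweep_def by fastforce
  then show ?thesis
    using compactin_minkowski_sum[OF K compactin_segment] by simp
qed

lemma subset_sweep:
  assumes "compactin (Rn_top n) K" "0 \<le> s"
  shows "K \<subseteq> sweep n K \<theta> s"
proof
  fix x assume x: "x \<in> K"
  then have "slide n x 0 \<theta> = x"
    using compactin_subset_Rn[OF assms(1)] by (auto intro: slide_0)
  with x assms(2) show "x \<in> sweep n K \<theta> s"
    by (metis order_refl sweepI)
qed

lemma convex_in_sweep:
  assumes K: "convex_in n K"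
  shows "convex_in n (sweep n K \<theta> s)"
  unfolding convex_in_def
proof (intro ballI)
  fix z w u assume "z \<in> sweep n K \<theta> s" "w \<in> sweep n K \<theta> s" and u: "u \<in> {0..1::real}"
  then obtain x p y q where z: "z = slide n x p \<theta>" "x \<in> K" "0 \<le> p" "p \<le> s"
    and w: "w = slide n y q \<theta>" "y \<in> K" "0 \<le> q" "q \<le> s"
    by (auto elim!: sweepE)
  have "vadd n (vscale n (1 - u) z) (vscale n u w)
      = slide n (\<lambda>i\<in>{..<n}. (1 - u) * x i + u * y i) ((1 - u) * p + u * q) \<theta>"
    by (auto simp: z w vadd_def vscale_def slide_def algebra_simps)
  moreover have "(1 - u) * p + u * q \<le> (1 - u) * s + u * s"
    using u z w by (intro add_mono mult_left_mono) auto
  then have "(1 - u) * p + u * q \<le> s"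
    by (simp add: algebra_simps)
  ultimately show "vadd n (vscale n (1 - u) z) (vscale n u w) \<in> sweep n K \<theta> s"
    using u z w by (auto intro!: sweepI convex_inD[OF K])
qed

text \<open>
  The layer added when the segment is prolonged by \<open>s\<close> is a translate of the layer added by sweeping
  \<open>K\<close> itself, since \<open>K\<close> meets every line parallel to \<open>\<theta>\<close> in an interval.
\<close>

lemma sweep_increment:
  assumes K: "convex_in n K" and KR: "K \<subseteq> Rn n" and s: "0 \<le> s" and u: "0 \<le> u"
  shows "sweep n K \<theta> (s + u) - sweep n K \<theta> u = {z \<in> Rn n. slide n z (- u) \<theta> \<in> sweep n K \<theta> s - K}"
proof (intro equalityI subsetI)
  fix z assume z: "z \<in> sweep n K \<theta> (s + u) - sweep n K \<theta> u"
  then obtain x r where x: "z = slide n x r \<theta>" "x \<in> K" "0 \<le> r" "r \<le> s + u"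
    by (auto elim: sweepE)
  have "u < r"
    using z x by (meson DiffD2 not_le_imp_less sweepI)
  then have 1: "slide n z (- u) \<theta> \<in> sweep n K \<theta> s"
    using x by (auto simp: slide_slide intro!: sweepI)
  have "z = slide n (slide n z (- u) \<theta>) u \<theta>"
    using x by (simp add: slide_slide)
  then have "slide n z (- u) \<theta> \<notin> K"
    using z u by (metis DiffD2 order_refl sweepI)
  with 1 show "z \<in> {z \<in> Rn n. slide n z (- u) \<theta> \<in> sweep n K \<theta> s - K}"
    by (simp add: x(1) slide_in_Rn)
next
  fix z assume z: "z \<in> {z \<in> Rn n. slide n z (- u) \<theta> \<in> sweep n K \<theta> s - K}"
  then obtain x r where x: "slide n z (- u) \<theta> = slide n x r \<theta>" "x \<in> K" "0 \<le> r" "r \<le> s"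
    by (auto elim: sweepE)
  have zR: "z \<in> Rn n" using z by simp
  have "z = slide n (slide n z (- u) \<theta>) u \<theta>"
    using zR by (simp add: slide_slide slide_0)
  then have zx: "z = slide n x (r + u) \<theta>"
    by (simp add: x(1) slide_slide)
  have "z \<notin> sweep n K \<theta> u"
  proof
    \<comment> \<open>otherwise \<open>z - u \<theta>\<close> lies between two points of \<open>K\<close> on the same line\<close>
    assume "z \<in> sweep n K \<theta> u"
    then obtain y q where y: "z = slide n y q \<theta>" "y \<in> K" "0 \<le> q" "q \<le> u"
      by (auto elim: sweepE)
    have "slide n z (- (r + u)) \<theta> = x"
      using zx x(2) KR by (auto simp: slide_slide slide_0)
    moreover have "slide n z (- q) \<theta> = y"
      using y KR by (auto simp: slide_slide slide_0)
    ultimately have "slide n z (- u) \<theta> \<in> K"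
      using x y by (intro slide_between[OF K, of z "- (r + u)" \<theta> "- q" "- u"]) auto
    then show False using z by simp
  qed
  moreover have "z \<in> sweep n K \<theta> (s + u)"
    unfolding zx using x u by (intro sweepI) auto
  ultimately show "z \<in> sweep n K \<theta> (s + u) - sweep n K \<theta> u" by simp
qed

text \<open>
  For convex \<open>K\<close>, by Cavalieri, this is \<open>s\<close> times the length of \<open>\<theta>\<close> times the volume of the projection of \<open>K\<close> along
  \<open>\<theta>\<close>. Working with the increment of volume replaces Fubini by translation invariance.
\<close>

definition growth :: "nat \<Rightarrow> (nat \<Rightarrow> real) set \<Rightarrow> (nat \<Rightarrow> real) \<Rightarrow> real \<Rightarrow> real" where
  "growth n K \<theta> s = vol n (sweep n K \<theta> s) - vol n K"

lemma vol_Diff: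
  assumes "compactin (Rn_top n) K" "compactin (Rn_top n) L" "K \<subseteq> L"
  shows "vol n (L - K) = vol n L - vol n K"
  unfolding vol_def
  using assms compactin_measurable compactin_finite_measure[OF assms(2)]
  by (intro measure_Diff) auto

lemma growth_nonneg: "compactin (Rn_top n) K \<Longrightarrow> 0 \<le> s \<Longrightarrow> 0 \<le> growth n K \<theta> s"
  unfolding growth_def by (simp add: vol_mono compactin_sweep subset_sweep compactin_measurable)

lemma growth_add:
  assumes K: "compactin (Rn_top n) K" "convex_in n K" and s: "0 \<le> s" and u: "0 \<le> u"
  shows "growth n K \<theta> (s + u) = growth n K \<theta> s + growth n K \<theta> u"
proof -
  have "vol n (sweep n K \<theta> (s + u)) - vol n (sweep n K \<theta> u) = vol n (sweep n K \<theta> (s + u) - sweep n K \<theta> u)"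
    using K s by (intro vol_Diff[symmetric] compactin_sweep sweep_mono) auto
  also have "\<dots> = vol n (sweep n K \<theta> s - K)"
    unfolding sweep_increment[OF K(2) compactin_subset_Rn[OF K(1)] s u]
    using K(1) by (intro vol_slide sets.Diff compactin_measurable compactin_sweep)
  also have "\<dots> = vol n (sweep n K \<theta> s) - vol n K"
    using K s by (intro vol_Diff compactin_sweep subset_sweep) auto
  finally show ?thesis
    by (simp add: growth_def)
qed

lemma growth_of_nat_mult:
  assumes K: "compactin (Rn_top n) K" "convex_in n K" and s: "0 \<le> s"
  shows "growth n K \<theta> (real m * s) = real m * growth n K \<theta> s"
proof (induction m)
  case 0
  have "growth n K \<theta> (0 + 0) = growth n K \<theta> 0 + growth n K \<theta> 0"
    by (intro growth_add[OF K]) auto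
  then show ?case by simp
next
  case (Suc m)
  have "growth n K \<theta> (real m * s + s) = growth n K \<theta> (real m * s) + growth n K \<theta> s"
    using s by (intro growth_add[OF K]) auto
  with Suc show ?case by (simp add: algebra_simps)
qed

text \<open>
  A larger set has a larger projection. In terms of volumes: compare the sweeps over a long segment
  \<open>m s \<theta>\<close>, where the volumes of \<open>K\<close> and \<open>L\<close> are negligible against \<open>m\<close> times the growth.
\<close>

lemma growth_mono:
  assumes K: "compactin (Rn_top n) K" "convex_in n K" and L: "compactin (Rn_top n) L" "convex_in n L"
    and KL: "K \<subseteq> L" and s: "0 \<le> s"
  shows "growth n K \<theta> s \<le> growth n L \<theta> s"
proof (rule ccontr)
  assume "\<not> ?thesis"
  then have d: "growth n K \<theta> s - growth n L \<theta> s > 0" by simp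
  obtain m :: nat where m: "vol n L < real m * (growth n K \<theta> s - growth n L \<theta> s)"
    using reals_Archimedean3[OF d] by blast
  have "vol n (sweep n K \<theta> (real m * s)) \<le> vol n (sweep n L \<theta> (real m * s))"
    using K L KL by (intro vol_mono sweep_mono compactin_sweep compactin_measurable) auto
  then have "vol n K + real m * growth n K \<theta> s \<le> vol n L + real m * growth n L \<theta> s"
    using growth_of_nat_mult[OF K s, of \<theta> m] growth_of_nat_mult[OF L s, of \<theta> m]
    by (simp add: growth_def)
  moreover have "0 \<le> vol n K" by (simp add: vol_def)
  ultimately show False using m by (simp add: algebra_simps)
qed

text \<open>
  The segments are added one at a time. Each increases the volume by the growth of the set reached so
  far, which by monotonicity is at least that of \<open>K\<close>.
\<close>

lemma zonotope_growth:
  assumes K: "compactin (Rn_top n) K" "convex_in n K" and J: "finite J"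
  obtains L where "compactin (Rn_top n) L" "convex_in n L" "K \<subseteq> L"
    "vol n K + (\<Sum>j\<in>J. growth n K (\<theta> j) 1) \<le> vol n L"
    "\<And>z. z \<in> L \<Longrightarrow> \<exists>x\<in>K. \<exists>s. (\<forall>j\<in>J. 0 \<le> s j \<and> s j \<le> 1) \<and> z = (\<lambda>i\<in>{..<n}. x i + (\<Sum>j\<in>J. s j * \<theta> j i))"
proof -
  have "\<exists>L. compactin (Rn_top n) L \<and> convex_in n L \<and> K \<subseteq> L \<and>
    vol n K + (\<Sum>j\<in>J. growth n K (\<theta> j) 1) \<le> vol n L \<and>
    (\<forall>z\<in>L. \<exists>x\<in>K. \<exists>s. (\<forall>j\<in>J. 0 \<le> s j \<and> s j \<le> 1) \<and> z = (\<lambda>i\<in>{..<n}. x i + (\<Sum>j\<in>J. s j * \<theta> j i)))"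
    using J
  proof induction
    case empty
    have "z = (\<lambda>i\<in>{..<n}. z i + (\<Sum>j\<in>{}. s j * \<theta> j i))" if "z \<in> K" for z s
    proof -
      have "z \<in> Rn n" using that compactin_subset_Rn[OF K(1)] by auto
      then show ?thesis by (auto simp: PiE_iff extensional_def)
    qed
    then show ?case using K by (intro exI[of _ K]) auto
  next
    case (insert a J)
    then obtain L where L: "compactin (Rn_top n) L" "convex_in n L" "K \<subseteq> L"
      "vol n K + (\<Sum>j\<in>J. growth n K (\<theta> j) 1) \<le> vol n L"
      "\<forall>z\<in>L. \<exists>x\<in>K. \<exists>s. (\<forall>j\<in>J. 0 \<le> s j \<and> s j \<le> 1) \<and> z = (\<lambda>i\<in>{..<n}. x i + (\<Sum>j\<in>J. s j * \<theta> j i))"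
      by blast
    let ?L = "sweep n L (\<theta> a) 1"
    have "growth n K (\<theta> a) 1 \<le> growth n L (\<theta> a) 1"
      using K L by (intro growth_mono) auto
    then have "vol n K + (\<Sum>j\<in>insert a J. growth n K (\<theta> j) 1) \<le> vol n ?L"
      using L(4) insert by (simp add: growth_def)
    moreover have "\<exists>x\<in>K. \<exists>s. (\<forall>j\<in>insert a J. 0 \<le> s j \<and> s j \<le> 1) \<and> z = (\<lambda>i\<in>{..<n}. x i + (\<Sum>j\<in>insert a J. s j * \<theta> j i))"
      if "z \<in> ?L" for z
    proof -
      obtain y r where y: "z = slide n y r (\<theta> a)" "y \<in> L" "0 \<le> r" "r \<le> 1"
        using \<open>z \<in> ?L\<close> by (rule sweepE)
      then obtain x s where x: "x \<in> K" "\<forall>j\<in>J. 0 \<le> s j \<and> s j \<le> 1" "y = (\<lambda>i\<in>{..<n}. x i + (\<Sum>j\<in>J. s j * \<theta> j i))"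
        using L(5) by blast
      let ?s = "s(a := r)"
      have "(\<Sum>j\<in>insert a J. ?s j * \<theta> j i) = r * \<theta> a i + (\<Sum>j\<in>J. s j * \<theta> j i)" for i
      proof -
        have "(\<Sum>j\<in>J. ?s j * \<theta> j i) = (\<Sum>j\<in>J. s j * \<theta> j i)"
          using insert(2) by (intro sum.cong) auto
        then show ?thesis using insert by simp
      qed
      then have "z = (\<lambda>i\<in>{..<n}. x i + (\<Sum>j\<in>insert a J. ?s j * \<theta> j i))"
        by (auto simp: y(1) x(3) slide_def)
      moreover have "\<forall>j\<in>insert a J. 0 \<le> ?s j \<and> ?s j \<le> 1" using x(2) y by auto
      ultimately show ?thesis using x(1) by blast
    qed
    moreover have "K \<subseteq> ?L" using L(3) subset_sweep[OF L(1), of 1 "\<theta> a"] by auto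
    ultimately show ?case
      using compactin_sweep[OF L(1), of "\<theta> a" 1] convex_in_sweep[OF L(2), of "\<theta> a" 1] by blast
  qed
  then show thesis using that by blast
qed

text \<open>
  The points of \<open>K\<close> that leave \<open>K\<close> when moved by \<open>s \<theta>\<close> are moved into the layer that the sweep adds.
\<close>

lemma overlap_lower_bound:
  assumes K: "compactin (Rn_top n) K" and s: "0 \<le> s"
  shows "vol n K - growth n K \<theta> s \<le> vol n {x \<in> K. slide n x s \<theta> \<in> K}"
proof -
  let ?O = "{x \<in> K. slide n x s \<theta> \<in> K}"
  have [measurable]: "K \<in> sets (Rn_leb n)" using compactin_measurable[OF K] .
  have "?O = K \<inter> ((\<lambda>x. slide n x s \<theta>) -` K \<inter> space (Rn_leb n))"
    using compactin_subset_Rn[OF K] by (auto simp: space_PiM)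
  then have O: "?O \<in> sets (Rn_leb n)"
    by (simp add: measurable_sets[OF measurable_slide] compactin_measurable[OF K])
  have fin: "emeasure (Rn_leb n) K \<noteq> \<infinity>"
    using compactin_finite_measure[OF K] by simp
  have D: "sweep n K \<theta> s - K \<in> sets (Rn_leb n)"
    using K by (intro sets.Diff compactin_measurable compactin_sweep)
  have KO: "K - ?O \<in> sets (Rn_leb n)"
    using O compactin_measurable[OF K] by auto
  have "vol n K - vol n ?O = vol n (K - ?O)"
    unfolding vol_def using O fin compactin_measurable[OF K] by (intro measure_Diff[symmetric]) auto
  also have "\<dots> = vol n {z \<in> Rn n. slide n z (- s) \<theta> \<in> K - ?O}"
    by (rule vol_slide[OF KO, symmetric])
  also have "\<dots> \<le> vol n (sweep n K \<theta> s - K)"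
  proof -
    have "{z \<in> Rn n. slide n z (- s) \<theta> \<in> K - ?O} \<subseteq> sweep n K \<theta> s - K"
    proof
      fix z assume z: "z \<in> {z \<in> Rn n. slide n z (- s) \<theta> \<in> K - ?O}"
      then have eq: "slide n (slide n z (- s) \<theta>) s \<theta> = z"
        by (simp add: slide_slide slide_0)
      from z have "slide n z (- s) \<theta> \<in> K" "slide n (slide n z (- s) \<theta>) s \<theta> \<notin> K"
        by auto
      then show "z \<in> sweep n K \<theta> s - K"
        using sweepI[of "slide n z (- s) \<theta>" K s s n \<theta>] s by (simp add: eq)
    qed
    moreover have "{z \<in> Rn n. slide n z (- s) \<theta> \<in> K - ?O}
        = (\<lambda>x. slide n x (- s) \<theta>) -` (K - ?O) \<inter> space (Rn_leb n)"
      by (auto simp: space_PiM)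
    then have "{z \<in> Rn n. slide n z (- s) \<theta> \<in> K - ?O} \<in> sets (Rn_leb n)"
      by (simp only: measurable_sets[OF measurable_slide KO])
    moreover have "sweep n K \<theta> s \<in> fmeasurable (Rn_leb n)"
      using compactin_finite_measure[OF compactin_sweep[OF K]] compactin_measurable[OF compactin_sweep[OF K]]
      by (rule fmeasurableI[rotated])
    then have "sweep n K \<theta> s - K \<in> fmeasurable (Rn_leb n)"
      using D by (rule fmeasurableI2[OF _ Diff_subset])
    ultimately show ?thesis
      unfolding vol_def by (rule measure_mono_fmeasurable)
  qed
  also have "\<dots> = growth n K \<theta> s"
    unfolding growth_def using K s by (intro vol_Diff compactin_sweep subset_sweep) auto
  finally show ?thesis by simp
qed

section \<open>Means of points of a convex set\<close>

lemma set_integral_finite_range: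
  fixes F :: "'b \<Rightarrow> real"
  assumes A: "emeasure M A < \<infinity>" and fin: "finite (g ` A)"
    and meas: "\<And>v. v \<in> g ` A \<Longrightarrow> {x \<in> A. g x = v} \<in> sets M"
  shows "set_integrable M A (\<lambda>x. F (g x))"
    and "(LINT x:A|M. F (g x)) = (\<Sum>v\<in>g ` A. measure M {x \<in> A. g x = v} * F v)"
proof -
  have AM: "A \<in> sets M"
  proof -
    have "A = (\<Union>v\<in>g ` A. {x \<in> A. g x = v})" by auto
    also have "\<dots> \<in> sets M" using fin meas by (intro sets.finite_UN)
    finally show ?thesis .
  qed
  have eq: "indicator A x *\<^sub>R F (g x) = (\<Sum>v\<in>g ` A. indicator {x \<in> A. g x = v} x * F v)" for x
  proof (cases "x \<in> A")
    case True
    then have "(\<Sum>v\<in>g ` A. indicator {x \<in> A. g x = v} x * F v) = (\<Sum>v\<in>g ` A. if v = g x then F v else 0)"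
      by (intro sum.cong) (auto simp: indicator_def)
    also have "\<dots> = F (g x)" using True fin by simp
    finally show ?thesis using True by simp
  qed (simp add: indicator_def)
  have int: "integrable M (\<lambda>x. indicator {x \<in> A. g x = v} x * F v)" if "v \<in> g ` A" for v
  proof -
    have "emeasure M {x \<in> A. g x = v} \<le> emeasure M A"
      using AM by (intro emeasure_mono) auto
    with A have "emeasure M {x \<in> A. g x = v} < \<infinity>" by (rule le_less_trans[rotated])
    with meas[OF that] show ?thesis by (intro integrable_mult_left integrable_real_indicator)
  qed
  show "set_integrable M A (\<lambda>x. F (g x))"
    unfolding set_integrable_def eq by (intro Bochner_Integration.integrable_sum int)
  have "(LINT x:A|M. F (g x)) = (\<Sum>v\<in>g ` A. (LINT x|M. indicator {x \<in> A. g x = v} x * F v))"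
    unfolding set_lebesgue_integral_def eq by (intro Bochner_Integration.integral_sum int)
  also have "\<dots> = (\<Sum>v\<in>g ` A. measure M {x \<in> A. g x = v} * F v)"
  proof (intro sum.cong refl)
    fix v assume "v \<in> g ` A"
    then have "{x \<in> A. g x = v} \<inter> space M = {x \<in> A. g x = v}"
      using sets.sets_into_space[OF meas] by blast
    then show "(LINT x|M. indicator {x \<in> A. g x = v} x * F v) = measure M {x \<in> A. g x = v} * F v"
      by simp
  qed
  finally show "(LINT x:A|M. F (g x)) = (\<Sum>v\<in>g ` A. measure M {x \<in> A. g x = v} * F v)" .
qed

lemma convex_in_weighted_mean:
  assumes K: "convex_in n K" and "finite S" "S \<noteq> {}"
    and "\<And>v. v \<in> S \<Longrightarrow> y v \<in> K" "\<And>v. v \<in> S \<Longrightarrow> 0 \<le> w v" "0 < sum w S"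
  shows "(\<lambda>i\<in>{..<n}. (\<Sum>v\<in>S. w v * y v i) / sum w S) \<in> K"
  using assms(2-)
proof (induction S rule: finite_ne_induct)
  case (singleton v)
  have "(\<lambda>i\<in>{..<n}. y v i) = (\<lambda>i\<in>{..<n}. (1 - 0) * y v i + 0 * y v i)" by simp
  also have "\<dots> \<in> K" using singleton by (intro convex_inD[OF K]) auto
  finally have "(\<lambda>i\<in>{..<n}. y v i) \<in> K" .
  moreover have "(\<lambda>i\<in>{..<n}. (\<Sum>x\<in>{v}. w x * y x i) / sum w {v}) = (\<lambda>i\<in>{..<n}. y v i)"
    using singleton by (intro restrict_ext) simp
  ultimately show ?case by (simp only:)
next
  case (insert a S)
  let ?W = "sum w S"
  have W: "?W \<ge> 0" using insert by (intro sum_nonneg) auto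
  have wa: "0 \<le> w a" "0 < w a + ?W" using insert by auto
  show ?case
  proof (cases "?W = 0")
    case True
    then have "w v = 0" if "v \<in> S" for v
      using insert that sum_nonneg_eq_0_iff[of S w] by auto
    then have "(\<lambda>i\<in>{..<n}. (\<Sum>v\<in>insert a S. w v * y v i) / sum w (insert a S))
        = (\<lambda>i\<in>{..<n}. (1 - 0) * y a i + 0 * y a i)"
      using insert True wa by (intro restrict_ext) simp
    moreover have "(\<lambda>i\<in>{..<n}. (1 - 0) * y a i + 0 * y a i) \<in> K"
      using insert by (intro convex_inD[OF K]) auto
    ultimately show ?thesis by (simp only:)
  next
    case False
    then have Wp: "?W > 0" using W by simp
    define z where "z = (\<lambda>i\<in>{..<n}. (\<Sum>v\<in>S. w v * y v i) / ?W)"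
    have z: "z \<in> K" unfolding z_def by (intro insert.IH) (use insert.prems Wp in auto)
    have "(\<lambda>i\<in>{..<n}. (1 - w a / (w a + ?W)) * z i + w a / (w a + ?W) * y a i) \<in> K"
      using wa Wp insert by (intro convex_inD[OF K z]) auto
    also have "(\<lambda>i\<in>{..<n}. (1 - w a / (w a + ?W)) * z i + w a / (w a + ?W) * y a i)
        = (\<lambda>i\<in>{..<n}. (\<Sum>v\<in>insert a S. w v * y v i) / sum w (insert a S))"
    proof (intro restrict_ext)
      fix i assume "i \<in> {..<n}"
      then have zi: "?W * z i = (\<Sum>v\<in>S. w v * y v i)" using Wp by (simp add: z_def)
      have "(1 - w a / (w a + ?W)) * z i = (?W * z i) / (w a + ?W)"
        using wa by (simp add: field_simps)
      then show "(1 - w a / (w a + ?W)) * z i + w a / (w a + ?W) * y a i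
          = (\<Sum>v\<in>insert a S. w v * y v i) / sum w (insert a S)"
        using insert by (simp add: zi add_divide_distrib)
    qed
    finally show ?thesis .
  qed
qed

text \<open>
  Points with the same grid value \<open>v\<close> are replaced by one representative \<open>y k v\<close> in \<open>K\<close>. The mean of
  the representatives is a finite convex combination of points of \<open>K\<close>, and it tends to the mean of \<open>X\<close>
  as the grid is refined.
\<close>

lemma mean_in_convex:
  assumes K: "compactin (Rn_top n) K" "convex_in n K"
    and A: "A \<in> sets M" "emeasure M A < \<infinity>" "0 < measure M A"
    and X: "\<And>x. x \<in> A \<Longrightarrow> X x \<in> K" "\<And>i. i < n \<Longrightarrow> (\<lambda>x. X x i) \<in> borel_measurable M"
  shows "(\<lambda>i\<in>{..<n}. (LINT x:A|M. X x i) / measure M A) \<in> K"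
proof -
  obtain R where R: "\<And>x i. x \<in> K \<Longrightarrow> i < n \<Longrightarrow> \<bar>x i\<bar> \<le> R"
    using compactin_bounded[OF K(1)] by metis
  have "\<forall>k v. \<exists>y. v \<in> grid n k ` K \<longrightarrow> y \<in> K \<and> grid n k y = v"
    by blast
  then obtain y where y: "\<And>k v. v \<in> grid n k ` K \<Longrightarrow> y k v \<in> K" "\<And>k v. v \<in> grid n k ` K \<Longrightarrow> grid n k (y k v) = v"
    by metis
  define g where "g k x = grid n k (X x)" for k x
  have fin: "finite (g k ` A)" for k
  proof -
    have "finite (grid n k ` X ` A)"
      by (rule finite_grid_image[of _ _ R]) (use X(1) R in auto)
    then show ?thesis by (simp add: g_def image_image)
  qed
  have meas: "{x \<in> A. g k x = v} \<in> sets M" if "v \<in> g k ` A" for k v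
  proof -
    have "v \<in> Rn n" using that grid_in_Rn by (auto simp: g_def)
    then have "A \<inter> {x \<in> space M. g k x = v} \<in> sets M"
      unfolding g_def using A(1) by (intro sets.Int measurable_grid_cell X(2))
    also have "A \<inter> {x \<in> space M. g k x = v} = {x \<in> A. g k x = v}"
      using sets.sets_into_space[OF A(1)] by auto
    finally show ?thesis .
  qed
  have gK: "v \<in> grid n k ` K" if "v \<in> g k ` A" for k v
    using that X(1) by (auto simp: g_def)
  note fr = set_integral_finite_range[OF A(2) fin meas]
  have "measure M A = (LINT x:A|M. 1)"
    using A sets.sets_into_space[OF A(1)] by (simp add: set_lebesgue_integral_def Int_absorb2)
  then have total: "measure M A = (\<Sum>v\<in>g k ` A. measure M {x \<in> A. g k x = v})" for k
    using fr(2)[of k "\<lambda>_. 1"] by simp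
  have A0: "A \<noteq> {}" using A(3) by auto
  define z where "z k = (\<lambda>i\<in>{..<n}. (\<Sum>v\<in>g k ` A. measure M {x \<in> A. g k x = v} * y k v i) / measure M A)" for k
  have zK: "z k \<in> K" for k
    unfolding z_def total[of k]
    using A0 A(3) by (intro convex_in_weighted_mean[OF K(2) fin]) (auto simp: y gK simp flip: total)
  have int: "set_integrable M A (\<lambda>x. X x i)" if "i < n" for i
  proof -
    have "integrable M (\<lambda>x. indicator A x * R)"
      using A by (intro integrable_mult_left integrable_real_indicator) auto
    moreover have "(\<lambda>x. indicator A x *\<^sub>R X x i) \<in> borel_measurable M"
      using X(2)[OF that] A(1) by measurable
    ultimately show ?thesis
      unfolding set_integrable_def
      by (rule Bochner_Integration.integrable_bound) (use R X(1) that in \<open>fastforce simp: indicator_def\<close>)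
  qed
  have lim: "(\<lambda>k. z k i) \<longlonglongrightarrow> (LINT x:A|M. X x i) / measure M A" if i: "i < n" for i
  proof -
    have diff: "\<bar>z k i - (LINT x:A|M. X x i) / measure M A\<bar> \<le> 2 / real (Suc k)" for k
    proof -
      have "\<bar>y k (g k x) i - X x i\<bar> \<le> 2 / real (Suc k)" if x: "x \<in> A" for x
      proof -
        have eq: "grid n k (y k (g k x)) = grid n k (X x)"
          using y(2) gK x by (auto simp: g_def)
        have "\<bar>y k (g k x) i - X x i\<bar> \<le> 1 / real (Suc k) + 1 / real (Suc k)"
          using grid_near[OF i, of k "y k (g k x)", unfolded eq] grid_near[OF i, of k "X x"] by linarith
        then show ?thesis by simp
      qed
      then have "(LINT x:A|M. \<bar>y k (g k x) i - X x i\<bar>) \<le> (LINT x:A|M. 2 / real (Suc k))"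
        using A int[OF i] fr(1)[of k "\<lambda>v. y k v i"]
        by (intro set_integral_mono set_integrable_abs set_integral_diff(1))
           (auto simp: set_integrable_def intro!: integrable_mult_left)
      also have "\<dots> = measure M A * (2 / real (Suc k))"
        using A sets.sets_into_space[OF A(1)] by (simp add: set_lebesgue_integral_def Int_absorb2)
      finally have "\<bar>LINT x:A|M. y k (g k x) i - X x i\<bar> \<le> measure M A * (2 / real (Suc k))"
        using set_integral_norm_bound[OF set_integral_diff(1)[OF fr(1)[of k "\<lambda>v. y k v i"] int[OF i]]] by simp
      moreover have "(LINT x:A|M. y k (g k x) i - X x i) = measure M A * (z k i - (LINT x:A|M. X x i) / measure M A)"
        using set_integral_diff(2)[OF fr(1)[of k "\<lambda>v. y k v i"] int[OF i]] fr(2)[of k "\<lambda>v. y k v i"] A(3) i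
        by (simp add: z_def right_diff_distrib)
      ultimately have "measure M A * \<bar>z k i - (LINT x:A|M. X x i) / measure M A\<bar> \<le> measure M A * (2 / real (Suc k))"
        using A(3) by (simp add: abs_mult)
      then show ?thesis
        using A(3) by (rule mult_left_le_imp_le)
    qed
    have "(\<lambda>k. 2 / real (Suc k)) \<longlonglongrightarrow> 0"
      by (rule tendsto_const_over_Suc)
    then have "(\<lambda>k. z k i - (LINT x:A|M. X x i) / measure M A) \<longlonglongrightarrow> 0"
      by (rule Lim_null_comparison[rotated]) (use diff in auto)
    then show ?thesis by (simp add: LIM_zero_iff)
  qed
  show ?thesis
    by (rule compactin_limit[of n K z, OF K(1) zK]) (use lim in auto)
qed

section \<open>Chords through the barycenter\<close>

abbreviation origin :: "nat \<Rightarrow> nat \<Rightarrow> real" where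
  "origin n \<equiv> (\<lambda>i\<in>{..<n}. 0)"

text \<open>
  The indices \<open>k\<close> for which \<open>x + d k \<theta>\<close> remains in \<open>K\<close> form an initial segment, so their number is the
  last of them. Counting instead of taking a maximum gives the length of the push towards the boundary
  as a sum of indicators, which is easy to integrate.
\<close>

lemma slide_in_if_count:
  assumes K: "convex_in n K" "x \<in> K" "x \<in> Rn n" and d: "0 \<le> d"
  shows "slide n x (d * real (card {k \<in> {1..m}. slide n x (d * real k) \<theta> \<in> K})) \<theta> \<in> K"
proof -
  let ?S = "{k \<in> {1..m}. slide n x (d * real k) \<theta> \<in> K}"
  have x0: "slide n x 0 \<theta> \<in> K" using K by (simp add: slide_0)
  show ?thesis
  proof (cases "?S = {}")
    case True
    then show ?thesis using x0 by (simp only: card.empty) simp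
  next
    case False
    have fin: "finite ?S" by simp
    define c where "c = Max ?S"
    have c: "c \<in> ?S" unfolding c_def using fin False by (rule Max_in)
    have "?S = {1..c}"
    proof
      show "?S \<subseteq> {1..c}"
      proof
        fix k assume k: "k \<in> ?S"
        have "k \<le> c" unfolding c_def by (rule Max_ge[OF fin k])
        with k show "k \<in> {1..c}" by simp
      qed
      show "{1..c} \<subseteq> ?S"
      proof
        fix k assume k: "k \<in> {1..c}"
        have "slide n x (d * real k) \<theta> \<in> K"
        proof (rule slide_between[OF K(1) x0])
          show "slide n x (d * real c) \<theta> \<in> K" using c by simp
          show "0 \<le> d * real k" using d by simp
          show "d * real k \<le> d * real c" using d k by (intro mult_left_mono) auto
        qed
        then show "k \<in> ?S" using c k by simp
      qed
    qed
    then have "card ?S = c" by simp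
    then show ?thesis using c by (simp only: mem_Collect_eq)
  qed
qed

text \<open>
  The mean of the pushed points \<open>x + d (c x) \<theta>\<close> over \<open>K\<close> lies in \<open>K\<close>. As \<open>K\<close> is centered, only the
  mean of \<open>d (c x)\<close> survives, and integrating the count \<open>c\<close> gives the volumes of the overlaps.
\<close>

lemma centered_chord_overlaps:
  assumes K: "compactin (Rn_top n) K" "convex_in n K" and V: "0 < vol n K"
    and cent: "centered n K" and d: "0 \<le> d"
  shows "slide n (origin n) (d * (\<Sum>k=1..m. vol n {x \<in> K. slide n x (d * real k) \<theta> \<in> K}) / vol n K) \<theta> \<in> K"
proof -
  let ?O = "\<lambda>k. {x \<in> K. slide n x (d * real k) \<theta> \<in> K}"
  have KM: "K \<in> sets (Rn_leb n)" and fin: "emeasure (Rn_leb n) K < \<infinity>"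
    using compactin_measurable[OF K(1)] compactin_finite_measure[OF K(1)] by auto
  have sub: "K \<subseteq> Rn n" using compactin_subset_Rn[OF K(1)] .
  have O: "?O k \<in> sets (Rn_leb n)" for k
  proof -
    have "?O k = K \<inter> ((\<lambda>x. slide n x (d * real k) \<theta>) -` K \<inter> space (Rn_leb n))"
      using sub by (auto simp: space_PiM)
    also have "\<dots> \<in> sets (Rn_leb n)"
      by (intro sets.Int KM measurable_sets[OF measurable_slide])
    finally show ?thesis .
  qed
  define c where "c x = (\<Sum>k=1..m. indicator (?O k) x :: real)" for x
  have c_card: "c x = real (card {k \<in> {1..m}. slide n x (d * real k) \<theta> \<in> K})" if "x \<in> K" for x
  proof -
    have "c x = (\<Sum>k\<in>{1..m}. if slide n x (d * real k) \<theta> \<in> K then 1 else 0)"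
      unfolding c_def using that by (intro sum.cong) (auto simp: indicator_def)
    also have "\<dots> = real (card {k \<in> {1..m}. slide n x (d * real k) \<theta> \<in> K})"
      by (simp add: sum.If_cases Int_def)
    finally show ?thesis .
  qed
  define X where "X x = slide n x (d * c x) \<theta>" for x
  have "(\<lambda>i\<in>{..<n}. (LINT x:K|Rn_leb n. X x i) / measure (Rn_leb n) K) \<in> K"
  proof (rule mean_in_convex[OF K KM fin])
    show "0 < measure (Rn_leb n) K" using V by (simp add: vol_def)
    show "X x \<in> K" if "x \<in> K" for x
      unfolding X_def c_card[OF that] using K(2) that sub d by (intro slide_in_if_count) auto
    show "(\<lambda>x. X x i) \<in> borel_measurable (Rn_leb n)" if "i < n" for i
      using that O measurable_coordinate[OF that] unfolding X_def slide_def c_def by simp measurable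
  qed
  also have "(\<lambda>i\<in>{..<n}. (LINT x:K|Rn_leb n. X x i) / measure (Rn_leb n) K)
    = slide n (origin n) (d * (\<Sum>k=1..m. vol n (?O k)) / vol n K) \<theta>"
    unfolding slide_def[of _ "origin n"]
  proof (intro restrict_ext)
    fix i assume "i \<in> {..<n}"
    then have i: "i < n" by simp
    obtain R where R: "\<And>x i. x \<in> K \<Longrightarrow> i < n \<Longrightarrow> \<bar>x i\<bar> \<le> R"
      using compactin_bounded[OF K(1)] by metis
    have int1: "set_integrable (Rn_leb n) K (\<lambda>x. x i)"
      unfolding set_integrable_def
    proof (rule Bochner_Integration.integrable_bound)
      show "integrable (Rn_leb n) (\<lambda>x. indicator K x * R)"
        using KM fin by (intro integrable_mult_left integrable_real_indicator) auto
      show "(\<lambda>x. indicator K x *\<^sub>R x i) \<in> borel_measurable (Rn_leb n)"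
        using measurable_coordinate[OF i] KM by measurable
      show "AE x in Rn_leb n. norm (indicator K x *\<^sub>R x i) \<le> norm (indicator K x * R)"
        using R i by (fastforce simp: indicator_def)
    qed
    have finO: "emeasure (Rn_leb n) (?O k) < \<infinity>" for k
      using emeasure_mono[of "?O k" K "Rn_leb n"] KM fin by (auto intro: le_less_trans)
    have intO: "integrable (Rn_leb n) (\<lambda>x. indicator (?O k) x :: real)" for k
      using O finO by (intro integrable_real_indicator) auto
    have Kc: "indicator K x * c x = c x" for x
      unfolding c_def by (auto simp: indicator_def)
    have int2: "integrable (Rn_leb n) c"
      unfolding c_def by (intro Bochner_Integration.integrable_sum intO)
    have c_int: "(LINT x|Rn_leb n. c x) = (\<Sum>k=1..m. vol n (?O k))"
    proof -
      have "(LINT x|Rn_leb n. c x) = (\<Sum>k=1..m. LINT x|Rn_leb n. indicator (?O k) x)"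
        unfolding c_def by (intro Bochner_Integration.integral_sum intO)
      also have "\<dots> = (\<Sum>k=1..m. vol n (?O k))"
        using sets.sets_into_space[OF O] by (intro sum.cong) (simp_all add: vol_def Int_absorb2)
      finally show ?thesis .
    qed
    have "(LINT x:K|Rn_leb n. X x i) = (LINT x|Rn_leb n. indicator K x * x i + d * \<theta> i * c x)"
      unfolding set_lebesgue_integral_def X_def slide_def
      using i Kc by (intro Bochner_Integration.integral_cong) (auto simp: algebra_simps indicator_def c_def)
    also have "\<dots> = (LINT x:K|Rn_leb n. x i) + d * \<theta> i * (\<Sum>k=1..m. vol n (?O k))"
      using int1 int2 unfolding set_integrable_def set_lebesgue_integral_def
      by (simp add: c_int)
    also have "(LINT x:K|Rn_leb n. x i) = 0"
    proof -
      have "(1 / vol n K) * (LINT x:K|Rn_leb n. x i) = 0"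
        using cent i unfolding centered_def barycenter_def by (metis (no_types, lifting) lessThan_iff restrict_apply')
      then show ?thesis using V by simp
    qed
    finally show "(LINT x:K|Rn_leb n. X x i) / measure (Rn_leb n) K
      = origin n i + d * (\<Sum>k=1..m. vol n (?O k)) / vol n K * \<theta> i"
      using i by (simp add: vol_def algebra_simps)
  qed
  finally show ?thesis .
qed

text \<open>
  The step length is \<open>1 / N\<close> and \<open>m\<close> steps are counted. With \<open>r = m / N\<close> the bound is about
  \<open>r (1 - r G / (2 |K|))\<close>, where \<open>G\<close> is the growth; it is largest for \<open>r = |K| / G\<close>, with value
  \<open>|K| / (2 G)\<close>.
\<close>

lemma centered_chord:
  assumes K: "compactin (Rn_top n) K" "convex_in n K" and V: "0 < vol n K"
    and cent: "centered n K" and N: "0 < N"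
  obtains u where "slide n (origin n) u \<theta> \<in> K"
    "real m / real N * (1 - (real m + 1) * growth n K \<theta> 1 / (2 * real N * vol n K)) \<le> u"
proof -
  define d where "d = 1 / real N"
  define G where "G = growth n K \<theta> 1"
  have d: "0 \<le> d" "real N * d = 1" using N by (auto simp: d_def)
  have Gd: "growth n K \<theta> d = d * G"
    using growth_of_nat_mult[OF K d(1), of \<theta> N] N unfolding d(2) by (simp add: G_def d_def field_simps)
  have "vol n K - real k * (d * G) \<le> vol n {x \<in> K. slide n x (d * real k) \<theta> \<in> K}" for k
    using overlap_lower_bound[OF K(1), of "d * real k" \<theta>] growth_of_nat_mult[OF K d(1), of \<theta> k] d(1)
    by (simp add: Gd mult.commute)
  then have "(\<Sum>k=1..m. vol n K - real k * (d * G)) \<le> (\<Sum>k=1..m. vol n {x \<in> K. slide n x (d * real k) \<theta> \<in> K})"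
    by (intro sum_mono)
  moreover have "(\<Sum>k=1..m. vol n K - real k * (d * G)) = real m * vol n K - real m * (real m + 1) / 2 * (d * G)"
    by (induction m) (auto simp: field_simps)
  ultimately have *: "real m * vol n K - real m * (real m + 1) / 2 * (d * G) \<le> (\<Sum>k=1..m. vol n {x \<in> K. slide n x (d * real k) \<theta> \<in> K})"
    by simp
  show thesis
  proof (rule that[OF centered_chord_overlaps[OF K V cent d(1)]])
    have "real m / real N * (1 - (real m + 1) * G / (2 * real N * vol n K))
        = d * (real m * vol n K - real m * (real m + 1) / 2 * (d * G)) / vol n K"
      using V N by (simp add: d_def field_simps)
    also have "\<dots> \<le> d * (\<Sum>k=1..m. vol n {x \<in> K. slide n x (d * real k) \<theta> \<in> K}) / vol n K"
      using * V d(1) by (intro divide_right_mono mult_left_mono) auto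
    finally show "real m / real N * (1 - (real m + 1) * growth n K \<theta> 1 / (2 * real N * vol n K))
        \<le> d * (\<Sum>k=1..m. vol n {x \<in> K. slide n x (d * real k) \<theta> \<in> K}) / vol n K"
      by (simp add: G_def)
  qed
qed

lemma minkowski_functional_le:
  "0 \<le> t \<Longrightarrow> x \<in> vscale n t ` K \<Longrightarrow> minkowski_functional n K x \<le> t"
  unfolding minkowski_functional_def by (intro cInf_lower) (auto intro: bdd_belowI[of _ 0])

lemma minkowski_functional_ge:
  assumes "0 \<le> t" "x \<in> vscale n t ` K" "\<And>s. 0 \<le> s \<Longrightarrow> x \<in> vscale n s ` K \<Longrightarrow> a \<le> s"
  shows "a \<le> minkowski_functional n K x"
  unfolding minkowski_functional_def using assms by (intro cInf_greatest) auto

lemma mem_vscale_if_slide: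
  assumes "slide n (origin n) u \<theta> \<in> K" "0 < u" "\<theta> \<in> Rn n"
  shows "\<theta> \<in> vscale n (1 / u) ` K"
proof -
  have "\<theta> = vscale n (1 / u) (slide n (origin n) u \<theta>)"
    using assms(2,3) by (auto simp: vscale_def slide_def PiE_iff extensional_def)
  with assms(1) show ?thesis by blast
qed

text \<open>
  A single, sufficiently short step already yields a chord of positive length. Hence the infimum in the
  Minkowski functional is taken over a nonempty set for every vector, that is, the origin is an interior
  point of a centered body.
\<close>

lemma centered_mem_vscale:
  assumes K: "compactin (Rn_top n) K" "convex_in n K" and V: "0 < vol n K"
    and cent: "centered n K" and \<theta>: "\<theta> \<in> Rn n"
  obtains t where "0 \<le> t" "\<theta> \<in> vscale n t ` K"
proof -
  obtain N :: nat where N: "growth n K \<theta> 1 / vol n K < real N"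
    using reals_Archimedean2 by blast
  have "0 \<le> growth n K \<theta> 1 / vol n K"
    using V growth_nonneg[OF K(1)] by simp
  then have N0: "0 < N" using N by (auto intro!: Nat.gr0I)
  obtain u where u: "slide n (origin n) u \<theta> \<in> K"
    "real 1 / real N * (1 - (real 1 + 1) * growth n K \<theta> 1 / (2 * real N * vol n K)) \<le> u"
    by (rule centered_chord[OF K V cent N0, of \<theta> 1])
  have "growth n K \<theta> 1 / (real N * vol n K) < 1"
    using N N0 V by (simp add: divide_simps mult.commute)
  then have "0 < real 1 / real N * (1 - (real 1 + 1) * growth n K \<theta> 1 / (2 * real N * vol n K))"
    using N0 by simp
  then have "0 < u" using u(2) by linarith
  then show thesis
    using that[of "1 / u"] mem_vscale_if_slide[OF u(1) _ \<theta>] by simp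
qed

lemma minkowski_functional_nonneg:
  assumes "compactin (Rn_top n) K" "convex_in n K" "0 < vol n K" "centered n K" "\<theta> \<in> Rn n"
  shows "0 \<le> minkowski_functional n K \<theta>"
  using centered_mem_vscale[OF assms] minkowski_functional_ge by metis

text \<open>
  The optimal chord of the previous estimate, reached in the limit of short steps. The factor \<open>2\<close> is
  sharp: equality holds for a cylinder with axis \<open>\<theta>\<close> and centre at the origin.
\<close>

proposition minkowski_functional_growth:
  assumes K: "compactin (Rn_top n) K" "convex_in n K" and V: "0 < vol n K"
    and cent: "centered n K" and \<theta>: "\<theta> \<in> Rn n"
  shows "vol n K * minkowski_functional n K \<theta> \<le> 2 * growth n K \<theta> 1"
proof -
  define f where "f = minkowski_functional n K \<theta>"
  define G where "G = growth n K \<theta> 1"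
  have f0: "0 \<le> f" unfolding f_def by (rule minkowski_functional_nonneg[OF assms])
  have G0: "0 \<le> G" unfolding G_def by (rule growth_nonneg[OF K(1)]) simp
  have key: "f * (real m / real N * (1 - (real m + 1) * G / (2 * real N * vol n K))) \<le> 1" if N: "0 < N" for m N
  proof -
    obtain u where u: "slide n (origin n) u \<theta> \<in> K"
      "real m / real N * (1 - (real m + 1) * G / (2 * real N * vol n K)) \<le> u"
      unfolding G_def by (rule centered_chord[OF K V cent N])
    show ?thesis
    proof (cases "0 < u")
      case True
      have "f \<le> 1 / u"
        unfolding f_def using True mem_vscale_if_slide[OF u(1) True \<theta>] by (intro minkowski_functional_le) auto
      then have "f * u \<le> 1" using True by (simp add: field_simps)
      then show ?thesis using mult_left_mono[OF u(2) f0] by linarith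
    next
      case False
      then have "f * (real m / real N * (1 - (real m + 1) * G / (2 * real N * vol n K))) \<le> f * 0"
        using u(2) f0 by (intro mult_left_mono) linarith+
      then show ?thesis by simp
    qed
  qed
  show ?thesis
  proof (cases "G = 0")
    case True
    \<comment> \<open>without growth the chords are arbitrarily long\<close>
    have "f \<le> 0"
    proof (rule ccontr)
      assume "\<not> f \<le> 0"
      then obtain m :: nat where "1 < real m * f" using reals_Archimedean3[of f] by auto
      moreover have "f * real m \<le> 1" using key[of 1 m] True by simp
      ultimately show False by (simp add: mult.commute)
    qed
    then show ?thesis using G0 f0 by (simp add: f_def G_def)
  next
    case False
    with G0 have G: "0 < G" by simp
    \<comment> \<open>the length that maximises the lower bound \<open>r (1 - r G / (2 |K|))\<close> for the chord\<close>
    define r where "r = vol n K / G"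
    have r: "0 < r" using V G by (simp add: r_def)
    have "f * ((r - 1 / real N) * (1 / 2 - G / (2 * vol n K) * (1 / real N))) \<le> 1"
      if N: "1 / r < real N" for N
    proof -
      have N0: "0 < N" using N r by (auto intro!: Nat.gr0I)
      define m where "m = nat \<lfloor>r * real N\<rfloor>"
      have m: "r * real N - 1 \<le> real m" "real m \<le> r * real N"
      proof -
        have "0 \<le> r * real N" using r by simp
        then show "r * real N - 1 \<le> real m" "real m \<le> r * real N"
          unfolding m_def by (linarith, rule of_nat_floor)
      qed
      have rN: "1 < r * real N" using N r by (simp add: field_simps)
      have a: "r - 1 / real N \<le> real m / real N" "0 \<le> r - 1 / real N"
      proof -
        have eq: "r - 1 / real N = (r * real N - 1) / real N" using N0 by (simp add: field_simps)
        show "r - 1 / real N \<le> real m / real N" unfolding eq using m by (intro divide_right_mono) auto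
        show "0 \<le> r - 1 / real N" unfolding eq using rN by simp
      qed
      have "(real m + 1) * G / (2 * real N * vol n K) \<le> (r * real N + 1) * G / (2 * real N * vol n K)"
        using m G V N0 by (intro divide_right_mono mult_right_mono) auto
      also have "\<dots> = 1 / 2 + G / (2 * vol n K) * (1 / real N)"
        using G V N0 by (simp add: r_def field_simps)
      finally have b: "1 / 2 - G / (2 * vol n K) * (1 / real N) \<le> 1 - (real m + 1) * G / (2 * real N * vol n K)"
        by simp
      have "0 \<le> 1 / 2 - G / (2 * vol n K) * (1 / real N)"
        using rN G V N0 by (simp add: r_def field_simps)
      then have "(r - 1 / real N) * (1 / 2 - G / (2 * vol n K) * (1 / real N))
          \<le> real m / real N * (1 - (real m + 1) * G / (2 * real N * vol n K))"
        using a b by (intro mult_mono) auto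
      from mult_left_mono[OF this f0] key[OF N0, of m] show ?thesis by linarith
    qed
    moreover have "(\<lambda>N. f * ((r - 1 / real N) * (1 / 2 - G / (2 * vol n K) * (1 / real N))))
        \<longlonglongrightarrow> f * ((r - 0) * (1 / 2 - G / (2 * vol n K) * 0))"
      by (intro tendsto_intros lim_1_over_n)
    moreover obtain N0 :: nat where "1 / r < real N0" using reals_Archimedean2 by blast
    ultimately have "f * ((r - 0) * (1 / 2 - G / (2 * vol n K) * 0)) \<le> 1"
      by (intro LIMSEQ_le_const2) (auto intro!: exI[of _ N0])
    then show ?thesis
      using G by (simp add: r_def f_def G_def field_simps)
  qed
qed

section \<open>The Minkowski functional of a centered body\<close>

lemma vnorm_nonneg [simp]: "0 \<le> vnorm n x"
  by (simp add: vnorm_def L2_set_nonneg)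

lemma vnorm_vscale: "vnorm n (vscale n a x) = \<bar>a\<bar> * vnorm n x"
proof -
  have "(\<Sum>i<n. (vscale n a x i)\<^sup>2) = a\<^sup>2 * (\<Sum>i<n. (x i)\<^sup>2)"
    by (simp add: vscale_def power_mult_distrib sum_distrib_left)
  then show ?thesis
    by (simp add: vnorm_def L2_set_def real_sqrt_mult)
qed

lemma vnorm_le_coordinate_bound:
  assumes "\<And>i. i < n \<Longrightarrow> \<bar>x i\<bar> \<le> e"
  shows "vnorm n x \<le> real n * e"
proof -
  have "vnorm n x \<le> (\<Sum>i<n. \<bar>x i\<bar>)"
    unfolding vnorm_def by (rule L2_set_le_sum_abs)
  also have "\<dots> \<le> (\<Sum>i<n. e)" using assms by (intro sum_mono) auto
  finally show ?thesis by simp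
qed

lemma abs_coordinate_le_vnorm: "i < n \<Longrightarrow> \<bar>x i\<bar> \<le> vnorm n x"
proof -
  assume "i < n"
  then have "(x i)\<^sup>2 \<le> (\<Sum>i<n. (x i)\<^sup>2)"
    by (intro member_le_sum[of i "{..<n}" "\<lambda>i. (x i)\<^sup>2"]) auto
  then show ?thesis
    unfolding vnorm_def L2_set_def by (intro real_le_rsqrt) simp
qed

lemma vscale_in_Rn: "vscale n a x \<in> Rn n"
  by (simp add: vscale_def)

lemma vscale_vscale: "vscale n a (vscale n b x) = vscale n (a * b) x"
  by (auto simp: vscale_def)

lemma vscale_1: "x \<in> Rn n \<Longrightarrow> vscale n 1 x = x"
  by (auto simp: vscale_def PiE_iff extensional_def)

lemma vol_pos_if_interior:
  assumes K: "compactin (Rn_top n) K" and int: "Rn_top n interior_of K \<noteq> {}"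
  shows "0 < vol n K"
proof -
  obtain x T where T: "openin (Rn_top n) T" "x \<in> T" "T \<subseteq> K"
    using int by (auto simp: interior_of_def)
  from openin_product_topology_alt[THEN iffD1, OF T(1), THEN bspec, OF T(2)]
  obtain U where op: "\<forall>i\<in>{..<n}. openin euclideanreal (U i)" and x: "x \<in> Pi\<^sub>E {..<n} U" and UT: "Pi\<^sub>E {..<n} U \<subseteq> T"
    by (elim exE conjE) (rule that)
  have U: "open (U i)" if "i < n" for i
    using bspec[OF op, of i] that by simp
  have "\<exists>d>0. {x i - d..x i + d} \<subseteq> U i" if "i < n" for i
  proof -
    have "x i \<in> U i" using x that by auto
    then obtain d where "d > 0" "cball (x i) d \<subseteq> U i"
      using U[OF \<open>i < n\<close>] open_contains_cball by blast
    then show ?thesis by (auto simp: cball_eq_atLeastAtMost)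
  qed
  then obtain d where d: "\<And>i. i < n \<Longrightarrow> d i > 0" "\<And>i. i < n \<Longrightarrow> {x i - d i..x i + d i} \<subseteq> U i"
    by metis
  let ?B = "\<Pi>\<^sub>E i\<in>{..<n}. {x i - d i..x i + d i}"
  have "vol n ?B = (\<Prod>i<n. (x i + d i) - (x i - d i))"
    using d(1) by (intro vol_box) (simp add: less_imp_le)
  also have "\<dots> > 0" using d(1) by (intro prod_pos) simp
  finally have "0 < vol n ?B" .
  also have "vol n ?B \<le> vol n K"
  proof (rule vol_mono[OF K])
    show "?B \<subseteq> K" using PiE_mono[of "{..<n}" "\<lambda>i. {x i - d i..x i + d i}" U] d(2) UT T(3) by auto
    show "?B \<in> sets (Rn_leb n)" by (intro sets_PiM_I_finite) auto
  qed
  finally show ?thesis .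
qed

locale centered_body =
  fixes n :: nat and K :: "(nat \<Rightarrow> real) set"
  assumes compact: "compactin (Rn_top n) K"
    and convex: "convex_in n K"
    and vol_pos: "0 < vol n K"
    and centered: "centered n K"
begin

abbreviation body_norm :: "(nat \<Rightarrow> real) \<Rightarrow> real" where
  "body_norm \<equiv> minkowski_functional n K"

lemmas body_norm_nonneg = minkowski_functional_nonneg[OF compact convex vol_pos centered]
lemmas mem_scaled_body = centered_mem_vscale[OF compact convex vol_pos centered]
lemmas body_norm_growth = minkowski_functional_growth[OF compact convex vol_pos centered]

lemma origin_mem: "origin n \<in> K"
proof -
  obtain u where "slide n (origin n) u (origin n) \<in> K"
    using centered_chord[OF compact convex vol_pos centered, of 1 "origin n" 1] by auto
  moreover have "slide n (origin n) u (origin n) = origin n"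
    by (auto simp: slide_def)
  ultimately show ?thesis by simp
qed

lemma body_norm_greatest:
  assumes "x \<in> Rn n" "\<And>s. 0 \<le> s \<Longrightarrow> x \<in> vscale n s ` K \<Longrightarrow> a \<le> s"
  shows "a \<le> body_norm x"
  using mem_scaled_body[OF assms(1)] minkowski_functional_ge[OF _ _ assms(2)] by metis

lemma body_norm_triangle:
  assumes x: "x \<in> Rn n" and y: "y \<in> Rn n"
  shows "body_norm (vadd n x y) \<le> body_norm x + body_norm y"
proof -
  have *: "body_norm (vadd n x y) \<le> s + t"
    if s: "0 \<le> s" "x \<in> vscale n s ` K" and t: "0 \<le> t" "y \<in> vscale n t ` K" for s t
  proof (rule minkowski_functional_le)
    show "0 \<le> s + t" using s t by simp
    obtain p q where p: "p \<in> K" "x = vscale n s p" and q: "q \<in> K" "y = vscale n t q"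
      using s t by auto
    show "vadd n x y \<in> vscale n (s + t) ` K"
    proof (cases "s + t = 0")
      case True
      then have "s = 0" "t = 0" using s t by auto
      then have "vadd n x y = vscale n (s + t) p"
        by (auto simp: p q vadd_def vscale_def)
      then show ?thesis using p by blast
    next
      case False
      then have st: "0 < s + t" using s t by simp
      have "(\<lambda>i\<in>{..<n}. (1 - t / (s + t)) * p i + t / (s + t) * q i) \<in> K"
        using st s t p q by (intro convex_inD[OF convex]) auto
      moreover have "vadd n x y = vscale n (s + t) (\<lambda>i\<in>{..<n}. (1 - t / (s + t)) * p i + t / (s + t) * q i)"
      proof -
        have "s * a + t * b = (s + t) * ((1 - t / (s + t)) * a + t / (s + t) * b)" for a b
        proof -
          define w where "w = t / (s + t)"
          have w: "(s + t) * w = t" using st by (simp add: w_def)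
          have "(s + t) * ((1 - w) * a + w * b) = (s + t) * a - ((s + t) * w) * a + ((s + t) * w) * b"
            by (simp add: algebra_simps)
          also have "\<dots> = s * a + t * b" unfolding w by (simp add: algebra_simps)
          finally have "s * a + t * b = (s + t) * ((1 - w) * a + w * b)" ..
          then show ?thesis by (simp only: w_def)
        qed
        then show ?thesis
          unfolding p q vadd_def vscale_def by (intro restrict_ext) simp
      qed
      ultimately show ?thesis by blast
    qed
  qed
  have "body_norm (vadd n x y) - body_norm y \<le> s" if s: "0 \<le> s" "x \<in> vscale n s ` K" for s
    using body_norm_greatest[OF y, of "body_norm (vadd n x y) - s"] *[OF s] by fastforce
  then have "body_norm (vadd n x y) - body_norm y \<le> body_norm x"
    by (rule body_norm_greatest[OF x])
  then show ?thesis by simp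
qed

lemma body_norm_vscale_le:
  assumes x: "x \<in> Rn n" and a: "0 \<le> a"
  shows "body_norm (vscale n a x) \<le> a * body_norm x"
proof (cases "a = 0")
  case True
  have "vscale n a x = vscale n 0 (origin n)" using True by (auto simp: vscale_def)
  then have "body_norm (vscale n a x) \<le> 0"
    using origin_mem by (intro minkowski_functional_le) auto
  then show ?thesis using True by simp
next
  case False
  have "body_norm (vscale n a x) / a \<le> s" if "0 \<le> s" "x \<in> vscale n s ` K" for s
  proof -
    have "body_norm (vscale n a x) \<le> a * s"
      using that a by (intro minkowski_functional_le) (auto simp: vscale_vscale)
    then show ?thesis using a False by (simp add: field_simps)
  qed
  then have "body_norm (vscale n a x) / a \<le> body_norm x"
    by (rule body_norm_greatest[OF x])
  then show ?thesis using a False by (simp add: field_simps)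
qed

lemma body_norm_vscale:
  assumes x: "x \<in> Rn n" and a: "0 \<le> a"
  shows "body_norm (vscale n a x) = a * body_norm x"
proof (cases "a = 0")
  case True
  then show ?thesis
    using body_norm_vscale_le[OF x a] body_norm_nonneg[OF vscale_in_Rn, of a x] by simp
next
  case False
  have "body_norm (vscale n (1 / a) (vscale n a x)) \<le> 1 / a * body_norm (vscale n a x)"
    using a by (intro body_norm_vscale_le vscale_in_Rn) auto
  then have "a * body_norm x \<le> body_norm (vscale n a x)"
    using False a x by (simp add: vscale_vscale vscale_1 field_simps)
  then show ?thesis using body_norm_vscale_le[OF x a] by simp
qed

text \<open>
  For \<open>x\<close> in the unit ball \<open>B\<close> the sweep along \<open>x\<close> is contained in \<open>K + B\<close>, so its growth, and with it
  the gauge of \<open>x\<close>, is bounded uniformly.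
\<close>

lemma body_norm_le_norm:
  obtains C where "0 < C" "\<And>x. x \<in> Rn n \<Longrightarrow> body_norm x \<le> C * vnorm n x"
proof -
  define C where "C = 2 * vol n (outer_parallel n K 1) / vol n K"
  have unit: "body_norm x \<le> C" if x: "x \<in> Rn n" "vnorm n x \<le> 1" for x
  proof -
    have "sweep n K x 1 \<subseteq> outer_parallel n K 1"
    proof
      fix z assume "z \<in> sweep n K x 1"
      then obtain y r where y: "z = slide n y r x" "y \<in> K" "0 \<le> r" "r \<le> 1" by (rule sweepE)
      have "z = vadd n y (vscale n 1 (vscale n r x))"
        by (auto simp: y(1) slide_def vadd_def vscale_def)
      moreover have "r * vnorm n x \<le> 1" using y x(2) by (simp add: mult_le_one)
      then have "vscale n r x \<in> unit_ball n"
        using y by (simp add: unit_ball_def vnorm_vscale vscale_in_Rn)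
      ultimately show "z \<in> outer_parallel n K 1"
        using y(2) unfolding outer_parallel_def by blast
    qed
    then have "growth n K x 1 \<le> vol n (outer_parallel n K 1)"
      using vol_mono[OF compactin_outer_parallel[OF compact] _ compactin_measurable[OF compactin_sweep[OF compact]]] vol_pos
      by (fastforce simp: growth_def)
    then have "vol n K * body_norm x \<le> 2 * vol n (outer_parallel n K 1)"
      using body_norm_growth[OF x(1)] by simp
    then show ?thesis using vol_pos by (simp add: C_def field_simps)
  qed
  have C0: "0 \<le> C" unfolding C_def using vol_pos by (simp add: vol_def)
  show thesis
  proof (rule that)
    show "0 < C + 1" using C0 by simp
    fix x assume x: "x \<in> Rn n"
    show "body_norm x \<le> (C + 1) * vnorm n x"
    proof (cases "vnorm n x = 0")
      case True
      have "x i = 0" if "i < n" for i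
        using abs_coordinate_le_vnorm[OF that, of x] True by simp
      then have "x = vscale n 0 x" using x by (auto simp: vscale_def PiE_iff extensional_def)
      then have "body_norm x = 0" using body_norm_vscale[OF x, of 0] by simp
      then show ?thesis using True by simp
    next
      case False
      then have p: "0 < vnorm n x" using vnorm_nonneg[of n x] by linarith
      let ?u = "vscale n (1 / vnorm n x) x"
      have "body_norm ?u \<le> C"
        using p by (intro unit) (simp_all add: vscale_in_Rn vnorm_vscale)
      moreover have "body_norm x = vnorm n x * body_norm ?u"
        using body_norm_vscale[OF x, of "1 / vnorm n x"] p by simp
      ultimately have "body_norm x \<le> vnorm n x * C"
        using p by (simp add: mult_left_mono)
      then show ?thesis using p by (simp add: algebra_simps)
    qed
  qed
qed

lemma ball_in_body:
  obtains r where "0 < r" "\<And>y. y \<in> unit_ball n \<Longrightarrow> vscale n r y \<in> K"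
proof -
  obtain C where C: "0 < C" "\<And>x. x \<in> Rn n \<Longrightarrow> body_norm x \<le> C * vnorm n x"
    by (rule body_norm_le_norm) blast
  show thesis
  proof (rule that[of "1 / (2 * C)"])
    show "0 < 1 / (2 * C)" using C by simp
    fix y assume "y \<in> unit_ball n"
    then have y: "y \<in> Rn n" "vnorm n y \<le> 1" by (auto simp: unit_ball_def)
    have "body_norm y \<le> C * 1" using C(1) y(2) by (intro order.trans[OF C(2)[OF y(1)]] mult_left_mono) auto
    then have "\<not> 2 * C \<le> body_norm y" using C(1) by simp
    then obtain s where s: "0 \<le> s" "y \<in> vscale n s ` K" "s < 2 * C"
      using body_norm_greatest[OF y(1), of "2 * C"] by fastforce
    then obtain k where k: "k \<in> K" "y = vscale n s k" by auto
    have "(\<lambda>i\<in>{..<n}. (1 - s / (2 * C)) * origin n i + s / (2 * C) * k i) \<in> K"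
      using s C by (intro convex_inD[OF convex origin_mem k(1)]) auto
    also have "(\<lambda>i\<in>{..<n}. (1 - s / (2 * C)) * origin n i + s / (2 * C) * k i) = vscale n (1 / (2 * C)) y"
      by (auto simp: k(2) vscale_def)
    finally show "vscale n (1 / (2 * C)) y \<in> K" .
  qed
qed

text \<open>
  If \<open>r B\<close> is contained in \<open>K\<close>, then \<open>K + t B\<close> is contained in \<open>(1 + t / r) K\<close>. So the
  difference quotients that define the surface area are bounded.
\<close>

lemma outer_parallel_volume_bound:
  obtains b \<delta> where "0 < \<delta>" "\<And>t. 0 < t \<Longrightarrow> t \<le> \<delta> \<Longrightarrow> (vol n (outer_parallel n K t) - vol n K) / t \<le> b"
proof -
  obtain r where r: "0 < r" "\<And>y. y \<in> unit_ball n \<Longrightarrow> vscale n r y \<in> K"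
    by (rule ball_in_body) blast
  \<comment> \<open>convexity of the power on \<open>[0, 1]\<close>, so that the difference quotient is bounded for \<open>t \<le> r\<close>\<close>
  have pow: "(1 + s) ^ m \<le> 1 + s * (2 ^ m - 1)" if "0 \<le> s" "s \<le> 1" for s :: real and m
  proof (induction m)
    case (Suc m)
    have "(1 + s) ^ Suc m \<le> (1 + s) * (1 + s * (2 ^ m - 1))"
      using Suc that by (simp add: mult_left_mono)
    also have "\<dots> = 1 + s * 2 ^ m + s * s * (2 ^ m - 1)"
      by (simp add: algebra_simps)
    also have "\<dots> \<le> 1 + s * 2 ^ m + s * 1 * (2 ^ m - 1)"
      using that by (intro add_left_mono mult_right_mono mult_left_mono) auto
    finally show ?case by (simp add: algebra_simps)
  qed simp
  show thesis
  proof (rule that)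
    show "0 < r" by fact
    fix t assume t: "0 < t" "t \<le> r"
    let ?c = "1 + t / r"
    have c: "1 \<le> ?c" "0 < ?c" "1 - t / r / ?c = 1 / ?c" using t r(1) by (auto simp: field_simps)
    let ?D = "{x \<in> Rn n. (\<lambda>i\<in>{..<n}. 1 / ?c * x i + 0) \<in> K}"
    have sub: "outer_parallel n K t \<subseteq> ?D"
    proof
      fix z assume "z \<in> outer_parallel n K t"
      then obtain x y where z: "z = vadd n x (vscale n t y)" "x \<in> K" "y \<in> unit_ball n"
        by (auto simp: outer_parallel_def)
      have "(\<lambda>i\<in>{..<n}. (1 - t / r / ?c) * x i + t / r / ?c * vscale n r y i) \<in> K"
      proof (rule convex_inD[OF convex z(2) r(2)[OF z(3)]])
        show "0 \<le> t / r / ?c" using t r(1) c(2) by simp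
        have "0 \<le> 1 / ?c" using c(2) by simp
        with c(3) show "t / r / ?c \<le> 1" by linarith
      qed
      also have "(\<lambda>i\<in>{..<n}. (1 - t / r / ?c) * x i + t / r / ?c * vscale n r y i) = (\<lambda>i\<in>{..<n}. 1 / ?c * z i + 0)"
        unfolding c(3) using r(1) c(2) by (auto simp: z(1) vadd_def vscale_def add_divide_distrib)
      finally have "(\<lambda>i\<in>{..<n}. 1 / ?c * z i + 0) \<in> K" .
      moreover have "z \<in> Rn n" unfolding z(1) by (simp add: vadd_def)
      ultimately show "z \<in> ?D" by (intro CollectI conjI)
    qed
    have "vol n K = (1 / ?c) ^ n * vol n ?D"
      using vol_affine[of "1 / ?c" K n "\<lambda>_. 0"] c compactin_measurable[OF compact] by (simp add: abs_of_pos)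
    then have D: "vol n ?D = ?c ^ n * vol n K"
      using c(2) by (simp add: power_divide)
    have fin: "emeasure (Rn_leb n) ?D \<noteq> \<infinity>"
    proof
      assume "emeasure (Rn_leb n) ?D = \<infinity>"
      then have "vol n ?D = 0" by (simp add: vol_def measure_def)
      with D vol_pos c(2) show False by simp
    qed
    have meas: "?D \<in> sets (Rn_leb n)"
    proof -
      have "?D = (\<lambda>x. \<lambda>i\<in>{..<n}. 1 / ?c * x i + 0) -` K \<inter> space (Rn_leb n)"
        by (auto simp: space_PiM)
      then show ?thesis
        by (simp only: measurable_sets[OF measurable_affine compactin_measurable[OF compact]])
    qed
    have "vol n (outer_parallel n K t) \<le> vol n ?D"
      unfolding vol_def
    proof (rule measure_mono_fmeasurable[OF sub])
      show "outer_parallel n K t \<in> sets (Rn_leb n)"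
        by (intro compactin_measurable compactin_outer_parallel compact)
      show "?D \<in> fmeasurable (Rn_leb n)"
        using meas fin by (intro fmeasurableI) (simp_all add: less_top)
    qed
    also have "\<dots> = ?c ^ n * vol n K" by (rule D)
    also have "\<dots> \<le> (1 + t / r * (2 ^ n - 1)) * vol n K"
      using t r(1) vol_pos by (intro mult_right_mono pow) auto
    finally have "vol n (outer_parallel n K t) - vol n K \<le> t * ((2 ^ n - 1) / r * vol n K)"
      by (simp add: algebra_simps diff_divide_distrib)
    then show "(vol n (outer_parallel n K t) - vol n K) / t \<le> (2 ^ n - 1) / r * vol n K"
      using t by (simp add: divide_le_eq mult.commute)
  qed
qed

end

text \<open>
  The upper bound also enters the first conclusion: it makes the lower limit finite, and an infinite one
  would be converted to \<open>0\<close>.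
\<close>

lemma surface_area_bounds:
  assumes "0 < \<delta>"
    and "\<And>t. 0 < t \<Longrightarrow> t \<le> \<delta> \<Longrightarrow> a \<le> (vol n (outer_parallel n K t) - vol n K) / t"
    and "\<And>t. 0 < t \<Longrightarrow> t \<le> \<delta> \<Longrightarrow> (vol n (outer_parallel n K t) - vol n K) / t \<le> b"
  shows "a \<le> surface_area n K" "surface_area n K \<le> b"
proof -
  let ?q = "\<lambda>t. ereal ((vol n (outer_parallel n K t) - vol n K) / t)"
  have ev: "\<forall>\<^sub>F t in at_right 0. 0 < t \<and> t \<le> \<delta>"
    unfolding eventually_at_right_field using assms(1) by (auto intro!: exI[of _ \<delta>])
  have "ereal a \<le> Liminf (at_right 0) ?q"
    using ev by (intro Liminf_bounded) (auto elim!: eventually_mono simp: assms(2))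
  moreover have "Liminf (at_right 0) ?q \<le> ereal b"
  proof -
    have "Liminf (at_right 0) ?q \<le> Limsup (at_right 0) ?q"
      by (rule Liminf_le_Limsup) simp
    also have "\<dots> \<le> ereal b"
      using ev by (intro Limsup_bounded) (auto elim!: eventually_mono simp: assms(3))
    finally show ?thesis .
  qed
  ultimately show "a \<le> surface_area n K" "surface_area n K \<le> b"
    unfolding surface_area_def by (cases "Liminf (at_right 0) ?q"; simp)+
qed

section \<open>Moments of the rotation invariant measure\<close>

text \<open>
  The rotation of the coordinates \<open>p\<close> and \<open>q\<close> with cosine \<open>c\<close> and sine \<open>s\<close>. The quarter turn and the
  turn by \<open>45\<close> degrees determine all moments that are needed.
\<close>

definition plane_rotation :: "nat \<Rightarrow> nat \<Rightarrow> real \<Rightarrow> real \<Rightarrow> nat \<Rightarrow> nat \<Rightarrow> real" where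
  "plane_rotation p q c s k l =
    (if k = l then (if k = p \<or> k = q then c else 1)
     else if k = p \<and> l = q then - s else if k = q \<and> l = p then s else 0)"

lemma plane_rotation_sum:
  assumes "p < n" "q < n" "p \<noteq> q" "k < n"
  shows "(\<Sum>l<n. plane_rotation p q c s k l * x l)
    = (if k = p then c * x p - s * x q else if k = q then s * x p + c * x q else x k)"
proof -
  have "(\<Sum>l<n. plane_rotation p q c s k l * x l)
      = (\<Sum>l<n. (if l = k then (if k = p \<or> k = q then c else 1) * x k else 0)
              + (if l = q then (if k = p then - s * x q else 0) else 0)
              + (if l = p then (if k = q then s * x p else 0) else 0))"
    using assms by (intro sum.cong) (auto simp: plane_rotation_def)
  also have "\<dots> = (if k = p then c * x p - s * x q else if k = q then s * x p + c * x q else x k)"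
    using assms by (simp add: sum.distrib)
  finally show ?thesis .
qed

lemma orthogonal_plane_rotation:
  assumes pq: "p < n" "q < n" "p \<noteq> q" and cs: "c\<^sup>2 + s\<^sup>2 = 1"
  shows "orthogonal_mat n (plane_rotation p q c s)"
  unfolding orthogonal_mat_def
proof (intro allI impI)
  fix i j assume ij: "i < n" "j < n"
  have "plane_rotation p q c s k i = plane_rotation p q c (- s) i k" for k
    by (auto simp: plane_rotation_def)
  then have "(\<Sum>k<n. plane_rotation p q c s k i * plane_rotation p q c s k j)
      = (\<Sum>k<n. plane_rotation p q c (- s) i k * plane_rotation p q c s k j)"
    by simp
  also have "\<dots> = (if i = j then 1 else 0)"
    unfolding plane_rotation_sum[OF pq ij(1)]
    using cs pq by (auto simp: plane_rotation_def power2_eq_square)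
  finally show "(\<Sum>k<n. plane_rotation p q c s k i * plane_rotation p q c s k j) = (if i = j then 1 else 0)" .
qed

lemma mat_apply_plane_rotation:
  assumes "p < n" "q < n" "p \<noteq> q"
  shows "mat_apply n (plane_rotation p q c s) x
    = (\<lambda>k\<in>{..<n}. if k = p then c * x p - s * x q else if k = q then s * x p + c * x q else x k)"
  unfolding mat_apply_def using assms by (intro restrict_ext plane_rotation_sum) auto

lemma vnorm_mat_apply:
  assumes "orthogonal_mat n A"
  shows "vnorm n (mat_apply n A x) = vnorm n x"
proof -
  have "(\<Sum>k<n. (mat_apply n A x k)\<^sup>2) = (\<Sum>k<n. \<Sum>i<n. \<Sum>j<n. A k i * A k j * (x i * x j))"
    unfolding power2_eq_square
    by (intro sum.cong refl) (simp add: mat_apply_def sum_product mult_ac)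
  also have "\<dots> = (\<Sum>i<n. \<Sum>k<n. \<Sum>j<n. A k i * A k j * (x i * x j))"
    by (rule sum.swap)
  also have "\<dots> = (\<Sum>i<n. \<Sum>j<n. \<Sum>k<n. A k i * A k j * (x i * x j))"
    by (intro sum.cong refl sum.swap)
  also have "\<dots> = (\<Sum>i<n. \<Sum>j<n. (if i = j then 1 else 0) * (x i * x j))"
    using assms unfolding orthogonal_mat_def
    by (intro sum.cong refl) (simp flip: sum_distrib_right)
  also have "\<dots> = (\<Sum>i<n. (x i)\<^sup>2)"
    by (intro sum.cong refl) (simp add: power2_eq_square if_distrib[where f = "\<lambda>a. a * _"] cong: if_cong)
  finally show ?thesis
    by (simp add: vnorm_def L2_set_def)
qed

lemma measurable_mat_apply: "mat_apply n A \<in> measurable (Rn_leb n) (Rn_leb n)"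
  unfolding mat_apply_def[abs_def] by (rule measurable_restrict) (simp add: measurable_coordinate)

locale sphere_measure =
  fixes n :: nat and \<sigma> :: "(nat \<Rightarrow> real) measure"
  assumes inv: "rotation_invariant_prob n \<sigma>" and dim: "2 \<le> n"
begin

sublocale prob_space \<sigma>
  using inv by (simp add: rotation_invariant_prob_def)

lemma sets_sphere: "sets \<sigma> = sets (restrict_space (Rn_leb n) (unit_sphere n))"
  using inv by (simp add: rotation_invariant_prob_def)

lemma space_sphere: "space \<sigma> = unit_sphere n"
  using sets_eq_imp_space_eq[OF sets_sphere] by (auto simp: space_restrict_space space_PiM unit_sphere_def)

lemma measurable_sphere:
  assumes "f \<in> measurable (Rn_leb n) N"
  shows "f \<in> measurable \<sigma> N"
  using measurable_restrict_space1[OF assms] measurable_cong_sets[OF sets_sphere refl] by blast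

lemma measurable_coordinate_sphere [measurable]: "i < n \<Longrightarrow> (\<lambda>\<xi>. \<xi> i) \<in> borel_measurable \<sigma>"
  by (intro measurable_sphere measurable_coordinate)

lemma measurable_orthogonal:
  assumes "orthogonal_mat n A"
  shows "mat_apply n A \<in> measurable \<sigma> \<sigma>"
proof -
  have "mat_apply n A \<in> measurable \<sigma> (restrict_space (Rn_leb n) (unit_sphere n))"
  proof (rule measurable_restrict_space2)
    show "mat_apply n A \<in> space \<sigma> \<rightarrow> unit_sphere n"
    proof
      fix \<xi> assume "\<xi> \<in> space \<sigma>"
      then have "vnorm n (mat_apply n A \<xi>) = 1"
        by (simp add: space_sphere unit_sphere_def vnorm_mat_apply[OF assms])
      moreover have "mat_apply n A \<xi> \<in> Rn n" by (simp add: mat_apply_def)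
      ultimately show "mat_apply n A \<xi> \<in> unit_sphere n" by (simp add: unit_sphere_def)
    qed
  qed (rule measurable_sphere[OF measurable_mat_apply])
  then show ?thesis
    by (simp only: measurable_cong_sets[OF refl sets_sphere])
qed

lemma integral_orthogonal:
  fixes g :: "(nat \<Rightarrow> real) \<Rightarrow> real"
  assumes A: "orthogonal_mat n A" and g: "g \<in> borel_measurable \<sigma>"
  shows "(LINT \<xi>|\<sigma>. g (mat_apply n A \<xi>)) = (LINT \<xi>|\<sigma>. g \<xi>)"
proof -
  have "(LINT \<xi>|\<sigma>. g (mat_apply n A \<xi>)) = (LINT \<xi>|distr \<sigma> \<sigma> (mat_apply n A). g \<xi>)"
    by (intro integral_distr[symmetric] measurable_orthogonal[OF A] g)
  also have "distr \<sigma> \<sigma> (mat_apply n A) = \<sigma>"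
    using inv A by (simp add: rotation_invariant_prob_def)
  finally show ?thesis .
qed

lemma integral_plane_rotation:
  fixes g :: "real \<Rightarrow> real \<Rightarrow> real"
  assumes pq: "p < n" "q < n" "p \<noteq> q" and cs: "c\<^sup>2 + s\<^sup>2 = 1"
    and g: "(\<lambda>\<xi>. g (\<xi> p) (\<xi> q)) \<in> borel_measurable \<sigma>"
  shows "(LINT \<xi>|\<sigma>. g (c * \<xi> p - s * \<xi> q) (s * \<xi> p + c * \<xi> q)) = (LINT \<xi>|\<sigma>. g (\<xi> p) (\<xi> q))"
  using integral_orthogonal[OF orthogonal_plane_rotation[OF pq cs] g] pq
  by (simp add: mat_apply_plane_rotation)

lemma coordinate_bound: "\<xi> \<in> space \<sigma> \<Longrightarrow> i < n \<Longrightarrow> \<bar>\<xi> i\<bar> \<le> 1"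
  using abs_coordinate_le_vnorm[of i n \<xi>] by (simp add: space_sphere unit_sphere_def)

lemma sum_squares_sphere: "\<xi> \<in> space \<sigma> \<Longrightarrow> (\<Sum>i<n. (\<xi> i)\<^sup>2) = 1"
  by (simp add: space_sphere unit_sphere_def vnorm_def L2_set_def)

lemma integrable_bounded:
  fixes g :: "(nat \<Rightarrow> real) \<Rightarrow> real"
  assumes "g \<in> borel_measurable \<sigma>" "\<And>\<xi>. \<xi> \<in> space \<sigma> \<Longrightarrow> \<bar>g \<xi>\<bar> \<le> B"
  shows "integrable \<sigma> g"
  using assms by (intro integrable_const_bound[where B = B]) auto

lemma integrable_monomial:
  assumes "i < n" "j < n"
  shows "integrable \<sigma> (\<lambda>\<xi>. \<xi> i ^ a * \<xi> j ^ b)"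
proof (rule integrable_bounded[where B = 1])
  show "(\<lambda>\<xi>. \<xi> i ^ a * \<xi> j ^ b) \<in> borel_measurable \<sigma>"
    using assms by measurable
  fix \<xi> assume "\<xi> \<in> space \<sigma>"
  then have "\<bar>\<xi> i\<bar> ^ a \<le> 1" "\<bar>\<xi> j\<bar> ^ b \<le> 1"
    using coordinate_bound assms by (auto intro: power_le_one)
  then show "\<bar>\<xi> i ^ a * \<xi> j ^ b\<bar> \<le> 1"
    by (simp add: abs_mult power_abs mult_le_one)
qed

lemma integrable_power: "i < n \<Longrightarrow> integrable \<sigma> (\<lambda>\<xi>. \<xi> i ^ a)"
  using integrable_monomial[of i i a 0] by simp

text \<open>
  The quarter turn maps \<open>\<xi>\<^sub>p \<xi>\<^sub>q\<close> to its negative.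
\<close>

lemma moment_mixed:
  assumes "p < n" "q < n" "p \<noteq> q"
  shows "(LINT \<xi>|\<sigma>. \<xi> p * \<xi> q) = 0"
proof -
  have "(LINT \<xi>|\<sigma>. - (\<xi> p * \<xi> q)) = (LINT \<xi>|\<sigma>. \<xi> p * \<xi> q)"
    using integral_plane_rotation[OF assms, of 0 1 "\<lambda>a b. a * b"] assms by (simp add: mult.commute)
  then show ?thesis by simp
qed

lemma moment_power_eq:
  assumes "p < n" "q < n" "even a"
  shows "(LINT \<xi>|\<sigma>. \<xi> p ^ a) = (LINT \<xi>|\<sigma>. \<xi> q ^ a)"
proof (cases "p = q")
  case False
  have "(LINT \<xi>|\<sigma>. (- \<xi> q) ^ a) = (LINT \<xi>|\<sigma>. \<xi> p ^ a)"
    using integral_plane_rotation[OF assms(1,2) False, of 0 1 "\<lambda>x y. x ^ a"] assms by simp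
  then show ?thesis using assms(3) by simp
qed simp

lemma moment_square:
  assumes p: "p < n"
  shows "(LINT \<xi>|\<sigma>. (\<xi> p)\<^sup>2) = 1 / real n"
proof -
  have "1 = (LINT \<xi>|\<sigma>. (\<Sum>i<n. (\<xi> i)\<^sup>2))"
  proof -
    have "(LINT \<xi>|\<sigma>. (\<Sum>i<n. (\<xi> i)\<^sup>2)) = (LINT \<xi>|\<sigma>. 1)"
      by (intro Bochner_Integration.integral_cong) (auto simp: sum_squares_sphere)
    then show ?thesis by (simp add: prob_space)
  qed
  also have "\<dots> = (\<Sum>i<n. LINT \<xi>|\<sigma>. (\<xi> i)\<^sup>2)"
    by (intro Bochner_Integration.integral_sum integrable_power) auto
  also have "\<dots> = (\<Sum>i<n. LINT \<xi>|\<sigma>. (\<xi> p)\<^sup>2)"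
    using p by (intro sum.cong moment_power_eq) auto
  finally show ?thesis using p by (simp add: field_simps)
qed

text \<open>
  By invariance under the turns by \<open>45\<close> and \<open>-45\<close> degrees, \<open>((\<xi>\<^sub>p - \<xi>\<^sub>q) / \<surd>2)\<^sup>4\<close> and
  \<open>((\<xi>\<^sub>p + \<xi>\<^sub>q) / \<surd>2)\<^sup>4\<close> both have the mean of \<open>\<xi>\<^sub>p\<^sup>4\<close>. In their sum the odd terms cancel.
\<close>

lemma moment_fourth_mixed:
  assumes pq: "p < n" "q < n" "p \<noteq> q"
  shows "3 * (LINT \<xi>|\<sigma>. (\<xi> p)\<^sup>2 * (\<xi> q)\<^sup>2) = (LINT \<xi>|\<sigma>. \<xi> p ^ 4)"
proof -
  define r where "r = 1 / sqrt 2"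
  have r: "r\<^sup>2 = 1 / 2" by (simp add: r_def power_divide)
  have r4: "r ^ 4 = 1 / 4"   proof -
    have "r ^ 4 = r\<^sup>2 * r\<^sup>2" by (simp add: power4_eq_xxxx power2_eq_square mult.assoc)
    then show ?thesis unfolding r by simp
  qed
  have rot: "(LINT \<xi>|\<sigma>. (r * \<xi> p - s * \<xi> q) ^ 4) = (LINT \<xi>|\<sigma>. \<xi> p ^ 4)" if "s\<^sup>2 = 1 / 2" for s
    using integral_plane_rotation[OF pq, of r s "\<lambda>x y. x ^ 4"] r that pq by simp
  have "2 * (LINT \<xi>|\<sigma>. \<xi> p ^ 4) = (LINT \<xi>|\<sigma>. (r * \<xi> p - r * \<xi> q) ^ 4) + (LINT \<xi>|\<sigma>. (r * \<xi> p - (- r) * \<xi> q) ^ 4)"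
    using rot[of r] rot[of "- r"] r by simp
  also have "\<dots> = (LINT \<xi>|\<sigma>. (r * \<xi> p - r * \<xi> q) ^ 4 + (r * \<xi> p - (- r) * \<xi> q) ^ 4)"
  proof (rule Bochner_Integration.integral_add[symmetric])
    have *: "integrable \<sigma> (\<lambda>\<xi>. (r * \<xi> p - s * \<xi> q) ^ 4)" for s
    proof -
      have "(\<lambda>\<xi>. (r * \<xi> p - s * \<xi> q) ^ 4) = (\<lambda>\<xi>. r ^ 4 * (\<xi> p ^ 4 * \<xi> q ^ 0) - 4 * r ^ 3 * s * (\<xi> p ^ 3 * \<xi> q ^ 1)
          + 6 * r ^ 2 * s ^ 2 * (\<xi> p ^ 2 * \<xi> q ^ 2) - 4 * r * s ^ 3 * (\<xi> p ^ 1 * \<xi> q ^ 3) + s ^ 4 * (\<xi> p ^ 0 * \<xi> q ^ 4))"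
        by (auto simp: power4_eq_xxxx power3_eq_cube power2_eq_square algebra_simps)
      then show ?thesis
        using pq by (simp only:) (intro integrable_monomial Bochner_Integration.integrable_add
            Bochner_Integration.integrable_diff integrable_mult_right; simp)
    qed
    show "integrable \<sigma> (\<lambda>\<xi>. (r * \<xi> p - r * \<xi> q) ^ 4)" "integrable \<sigma> (\<lambda>\<xi>. (r * \<xi> p - (- r) * \<xi> q) ^ 4)"
      by (rule *)+
  qed
  also have "\<dots> = (LINT \<xi>|\<sigma>. 2 * r ^ 4 * (\<xi> p ^ 4 + \<xi> q ^ 4 + 6 * ((\<xi> p)\<^sup>2 * (\<xi> q)\<^sup>2)))"
    by (intro Bochner_Integration.integral_cong refl)
       (simp add: power4_eq_xxxx power2_eq_square algebra_simps)
  also have "\<dots> = 1 / 2 * ((LINT \<xi>|\<sigma>. \<xi> p ^ 4) + (LINT \<xi>|\<sigma>. \<xi> q ^ 4) + 6 * (LINT \<xi>|\<sigma>. (\<xi> p)\<^sup>2 * (\<xi> q)\<^sup>2))"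
    using pq by (simp add: r4 integrable_power integrable_monomial)
  also have "(LINT \<xi>|\<sigma>. \<xi> q ^ 4) = (LINT \<xi>|\<sigma>. \<xi> p ^ 4)"
    using pq by (intro moment_power_eq) auto
  finally show ?thesis by simp
qed

lemma moment_fourth:
  assumes p: "p < n"
  shows "(LINT \<xi>|\<sigma>. \<xi> p ^ 4) = 3 / (real n * (real n + 2))"
proof -
  let ?m = "LINT \<xi>|\<sigma>. \<xi> p ^ 4"
  have "1 / real n = (LINT \<xi>|\<sigma>. (\<Sum>i<n. (\<xi> p)\<^sup>2 * (\<xi> i)\<^sup>2))"
  proof -
    have "(LINT \<xi>|\<sigma>. (\<Sum>i<n. (\<xi> p)\<^sup>2 * (\<xi> i)\<^sup>2)) = (LINT \<xi>|\<sigma>. (\<xi> p)\<^sup>2)"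
      by (intro Bochner_Integration.integral_cong) (auto simp: sum_squares_sphere simp flip: sum_distrib_left)
    then show ?thesis by (simp add: moment_square[OF p])
  qed
  also have "\<dots> = (\<Sum>i<n. LINT \<xi>|\<sigma>. (\<xi> p)\<^sup>2 * (\<xi> i)\<^sup>2)"
    using p by (intro Bochner_Integration.integral_sum integrable_monomial) auto
  also have "\<dots> = (LINT \<xi>|\<sigma>. (\<xi> p)\<^sup>2 * (\<xi> p)\<^sup>2) + (\<Sum>i\<in>{..<n} - {p}. LINT \<xi>|\<sigma>. (\<xi> p)\<^sup>2 * (\<xi> i)\<^sup>2)"
    using p by (intro sum.remove) auto
  also have "(LINT \<xi>|\<sigma>. (\<xi> p)\<^sup>2 * (\<xi> p)\<^sup>2) = ?m"
    by (simp add: power4_eq_xxxx power2_eq_square mult.assoc)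
  also have "(\<Sum>i\<in>{..<n} - {p}. LINT \<xi>|\<sigma>. (\<xi> p)\<^sup>2 * (\<xi> i)\<^sup>2) = (\<Sum>i\<in>{..<n} - {p}. ?m / 3)"
  proof (intro sum.cong refl)
    fix i assume "i \<in> {..<n} - {p}"
    then show "(LINT \<xi>|\<sigma>. (\<xi> p)\<^sup>2 * (\<xi> i)\<^sup>2) = ?m / 3"
      using moment_fourth_mixed[OF p, of i] by auto
  qed
  also have "?m + (\<Sum>i\<in>{..<n} - {p}. ?m / 3) = ?m * (real n + 2) / 3"
    using p by (simp add: of_nat_diff field_simps)
  finally have "?m * (real n * (real n + 2)) = 3" using p by (simp add: field_simps)
  moreover have "real n * (real n + 2) \<noteq> 0" using p by simp
  ultimately show ?thesis by (intro eq_divide_imp)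
qed

text \<open>
  An even polynomial of degree four lying below the absolute value and touching it at
  \<open>3 / (2 \<surd>n)\<close>, the natural scale of a coordinate, turns the second and fourth moments into a lower bound.
\<close>

lemma first_absolute_moment_ge:
  assumes p: "p < n"
  shows "5 / (9 * sqrt (real n)) \<le> (LINT \<xi>|\<sigma>. \<bar>\<xi> p\<bar>)"
proof -
  define a where "a = sqrt (real n)"
  have a: "0 < a" "a\<^sup>2 = real n" using dim by (auto simp: a_def)
  \<comment> \<open>\<open>1 - v + 4 v\<^sup>3 / 27 = (2 v - 3)\<^sup>2 (v + 3) / 27 \<ge> 0\<close> at \<open>v = a \<bar>\<xi> p\<bar>\<close>\<close>
  have pt: "a * x\<^sup>2 - 4 / 27 * a ^ 3 * x ^ 4 \<le> \<bar>x\<bar>" for x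
  proof -
    define v where "v = a * \<bar>x\<bar>"
    have v: "0 \<le> v" using a by (simp add: v_def)
    have "0 \<le> (2 * v - 3)\<^sup>2 * (v + 3) / 27 * \<bar>x\<bar>" using v by simp
    also have "(2 * v - 3)\<^sup>2 * (v + 3) = 27 - 27 * v + 4 * v ^ 3"
      by (simp add: power2_eq_square power3_eq_cube algebra_simps)
    also have "\<dots> / 27 * \<bar>x\<bar> = \<bar>x\<bar> - v * \<bar>x\<bar> + 4 / 27 * v ^ 3 * \<bar>x\<bar>"
      by (simp add: algebra_simps add_divide_distrib diff_divide_distrib)
    also have "v * \<bar>x\<bar> = a * x\<^sup>2" by (simp add: v_def power2_eq_square)
    also have "4 / 27 * v ^ 3 * \<bar>x\<bar> = 4 / 27 * a ^ 3 * x ^ 4"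
    proof -
      have "\<bar>x\<bar> ^ 4 = x ^ 4" by simp
      then show ?thesis by (simp add: v_def power_mult_distrib power3_eq_cube power4_eq_xxxx)
    qed
    finally show ?thesis by simp
  qed
  have "5 / 9 / a \<le> a * (1 / real n) - 4 / 27 * a ^ 3 * (3 / (real n * (real n + 2)))"
  proof -
    have eq: "a * (1 / real n) - 4 / 27 * a ^ 3 * (3 / (real n * (real n + 2))) = 1 / a - 4 / 9 * (a / (a\<^sup>2 + 2))"
    proof -
      have "a * (1 / a\<^sup>2) - 4 / 27 * a ^ 3 * (3 / (a\<^sup>2 * b)) = 1 / a - 4 / 9 * a / b" if "0 < b" for b
        using a(1) that by (simp add: power2_eq_square power3_eq_cube field_simps)
      from this[of "a\<^sup>2 + 2"] show ?thesis
        unfolding a(2)[symmetric] by (simp add: add_nonneg_pos)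
    qed
    have le: "a / (a\<^sup>2 + 2) \<le> 1 / a"
    proof -
      have "a / (a\<^sup>2 + 2) \<le> a / a\<^sup>2" using a(1) by (intro divide_left_mono mult_pos_pos add_pos_pos) simp_all
      then show ?thesis using a(1) by (simp add: power2_eq_square)
    qed
    have "5 / 9 / a = 1 / a - 4 / 9 * (1 / a)" by simp
    also have "\<dots> \<le> 1 / a - 4 / 9 * (a / (a\<^sup>2 + 2))"
      by (intro diff_left_mono mult_left_mono le) simp
    finally show ?thesis unfolding eq .
  qed
  also have "\<dots> = (LINT \<xi>|\<sigma>. a * (\<xi> p)\<^sup>2 - 4 / 27 * a ^ 3 * \<xi> p ^ 4)"
    using p by (simp add: integrable_power moment_square moment_fourth)
  also have "\<dots> \<le> (LINT \<xi>|\<sigma>. \<bar>\<xi> p\<bar>)"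
    using p pt by (intro integral_mono Bochner_Integration.integrable_diff integrable_mult_right integrable_power
        integrable_abs) (auto intro: integrable_power[of p 1, simplified])
  finally show ?thesis by (simp add: a_def)
qed

lemma integrable_linear:
  "integrable \<sigma> (\<lambda>\<xi>. \<Sum>i<n. \<xi> i * y i)"
  using integrable_power[of _ 1] by (intro Bochner_Integration.integrable_sum integrable_mult_left) auto

lemma second_moment_linear:
  "(LINT \<xi>|\<sigma>. (\<Sum>i<n. \<xi> i * y i)\<^sup>2) = (vnorm n y)\<^sup>2 / real n"
proof -
  have "(LINT \<xi>|\<sigma>. (\<Sum>i<n. \<xi> i * y i)\<^sup>2) = (LINT \<xi>|\<sigma>. (\<Sum>i<n. \<Sum>j<n. y i * y j * (\<xi> i ^ 1 * \<xi> j ^ 1)))"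
    by (intro Bochner_Integration.integral_cong) (auto simp: power2_eq_square sum_product mult_ac)
  also have "\<dots> = (\<Sum>i<n. \<Sum>j<n. y i * y j * (LINT \<xi>|\<sigma>. \<xi> i ^ 1 * \<xi> j ^ 1))"
  proof -
    have int: "integrable \<sigma> (\<lambda>\<xi>. y i * y j * (\<xi> i ^ 1 * \<xi> j ^ 1))" if "i < n" "j < n" for i j
      using that by (intro integrable_mult_right integrable_monomial)
    then show ?thesis
      by (subst Bochner_Integration.integral_sum, force intro: Bochner_Integration.integrable_sum)
         (intro sum.cong refl, subst Bochner_Integration.integral_sum, auto)
  qed
  also have "\<dots> = (\<Sum>i<n. \<Sum>j<n. if j = i then (y i)\<^sup>2 / real n else 0)"
    by (intro sum.cong refl) (auto simp: moment_mixed moment_square simp flip: power2_eq_square)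
  also have "\<dots> = (vnorm n y)\<^sup>2 / real n"
    by (simp add: vnorm_def L2_set_def sum_nonneg sum_divide_distrib)
  finally show ?thesis .
qed

text \<open>
  Jensen's inequality for the square, in the pointwise form
  \<open>2 \<bar>x\<bar> \<le> l x\<^sup>2 + 1 / l\<close> with \<open>l\<close> the inverse of the standard deviation.
\<close>

lemma first_moment_linear:
  "(LINT \<xi>|\<sigma>. \<bar>\<Sum>i<n. \<xi> i * y i\<bar>) \<le> vnorm n y / sqrt (real n)"
proof (cases "vnorm n y = 0")
  case True
  then have "y i = 0" if "i < n" for i
    using abs_coordinate_le_vnorm[OF that, of y] by simp
  then show ?thesis using True by simp
next
  case False
  then have v: "0 < vnorm n y" using vnorm_nonneg[of n y] by linarith
  define l where "l = sqrt (real n) / vnorm n y"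
  have l: "0 < l" using v dim by (simp add: l_def)
  have pt: "\<bar>x\<bar> \<le> (l * x\<^sup>2 + 1 / l) / 2" for x
  proof -
    have "0 \<le> (l * \<bar>x\<bar> - 1)\<^sup>2 / l" using l by simp
    also have "\<dots> = l * x\<^sup>2 - 2 * \<bar>x\<bar> + 1 / l"
      using l by (simp add: power2_eq_square field_simps)
    finally show ?thesis by simp
  qed
  have int2: "integrable \<sigma> (\<lambda>\<xi>. (\<Sum>i<n. \<xi> i * y i)\<^sup>2)"
  proof -
    have "(\<lambda>\<xi>. (\<Sum>i<n. \<xi> i * y i)\<^sup>2) = (\<lambda>\<xi>. (\<Sum>i<n. \<Sum>j<n. y i * y j * (\<xi> i ^ 1 * \<xi> j ^ 1)))"
      by (auto simp: power2_eq_square sum_product mult_ac)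
    then show ?thesis
      by (simp only:) (intro Bochner_Integration.integrable_sum integrable_mult_right integrable_monomial; simp)
  qed
  have "(LINT \<xi>|\<sigma>. \<bar>\<Sum>i<n. \<xi> i * y i\<bar>) \<le> (LINT \<xi>|\<sigma>. (l * (\<Sum>i<n. \<xi> i * y i)\<^sup>2 + 1 / l) / 2)"
    using pt int2 by (intro integral_mono integrable_abs integrable_linear) auto
  also have "\<dots> = (l * ((vnorm n y)\<^sup>2 / real n) + 1 / l) / 2"
    using int2 by (simp add: second_moment_linear prob_space)
  also have "\<dots> = vnorm n y / sqrt (real n)"
  proof -
    have "real n = sqrt (real n) * sqrt (real n)" by simp
    then have "l * ((vnorm n y)\<^sup>2 / real n) = vnorm n y / sqrt (real n)"
      using v dim by (simp add: l_def power2_eq_square field_simps)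
    moreover have "1 / l = vnorm n y / sqrt (real n)" by (simp add: l_def)
    ultimately show ?thesis by simp
  qed
  finally show ?thesis .
qed

end

section \<open>The lower bound for the surface area\<close>

locale centered_body_sphere = centered_body n K + sphere_measure n \<sigma>
  for n :: nat and K :: "(nat \<Rightarrow> real) set" and \<sigma> :: "(nat \<Rightarrow> real) measure"
begin

lemma sphere_subset_Rn: "\<xi> \<in> space \<sigma> \<Longrightarrow> \<xi> \<in> Rn n"
  by (simp add: space_sphere unit_sphere_def)

lemma finite_grid_sphere: "finite (grid n k ` space \<sigma>)"
  by (rule finite_grid_image[of _ _ 1]) (rule coordinate_bound)

lemma grid_cell_sphere:
  assumes "v \<in> grid n k ` space \<sigma>"
  shows "{\<xi> \<in> space \<sigma>. grid n k \<xi> = v} \<in> sets \<sigma>"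
proof -
  have "v \<in> Rn n" using assms grid_in_Rn by blast
  with measurable_coordinate_sphere show ?thesis
    by (rule measurable_grid_cell[of n "\<lambda>\<xi>. \<xi>"])
qed

lemma integral_grid_sphere:
  fixes F :: "(nat \<Rightarrow> real) \<Rightarrow> real"
  shows "integrable \<sigma> (\<lambda>\<xi>. F (grid n k \<xi>))"
    and "(LINT \<xi>|\<sigma>. F (grid n k \<xi>)) = (\<Sum>v\<in>grid n k ` space \<sigma>. measure \<sigma> {\<xi> \<in> space \<sigma>. grid n k \<xi> = v} * F v)"
proof -
  have fin: "emeasure \<sigma> (space \<sigma>) < \<infinity>" by (simp add: emeasure_space_1)
  note * = set_integral_finite_range[of \<sigma> "space \<sigma>" "grid n k", OF fin finite_grid_sphere grid_cell_sphere, of F]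
  have ind: "indicator (space \<sigma>) \<xi> *\<^sub>R F (grid n k \<xi>) = F (grid n k \<xi>)" if "\<xi> \<in> space \<sigma>" for \<xi>
    using that by simp
  show int: "integrable \<sigma> (\<lambda>\<xi>. F (grid n k \<xi>))"
  proof -
    have "integrable \<sigma> (\<lambda>\<xi>. indicator (space \<sigma>) \<xi> *\<^sub>R F (grid n k \<xi>)) = integrable \<sigma> (\<lambda>\<xi>. F (grid n k \<xi>))"
      by (intro Bochner_Integration.integrable_cong refl ind)
    with *(1) show ?thesis unfolding set_integrable_def by blast
  qed
  show "(LINT \<xi>|\<sigma>. F (grid n k \<xi>)) = (\<Sum>v\<in>grid n k ` space \<sigma>. measure \<sigma> {\<xi> \<in> space \<sigma>. grid n k \<xi> = v} * F v)"
    using *(2) set_integral_space[OF int] by simp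
qed

lemma body_norm_lipschitz:
  obtains C where "0 < C"
    "\<And>x y e. x \<in> Rn n \<Longrightarrow> y \<in> Rn n \<Longrightarrow> (\<And>i. i < n \<Longrightarrow> \<bar>x i - y i\<bar> \<le> e) \<Longrightarrow> body_norm x \<le> body_norm y + C * e"
proof -
  obtain C where C: "0 < C" "\<And>x. x \<in> Rn n \<Longrightarrow> body_norm x \<le> C * vnorm n x"
    by (rule body_norm_le_norm) blast
  show thesis
  proof (rule that[of "C * real n"])
    show "0 < C * real n" using C dim by simp
    fix x y e assume x: "x \<in> Rn n" and y: "y \<in> Rn n" and e: "\<And>i. i < n \<Longrightarrow> \<bar>x i - y i\<bar> \<le> e"
    define d where "d = (\<lambda>i\<in>{..<n}. x i - y i)"
    have d: "d \<in> Rn n" by (simp add: d_def)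
    have "x = vadd n y d" using x by (auto simp: d_def vadd_def PiE_iff extensional_def)
    then have "body_norm x \<le> body_norm y + body_norm d"
      using body_norm_triangle[OF y d] by simp
    also have "body_norm d \<le> C * vnorm n d" by (rule C(2)[OF d])
    also have "vnorm n d \<le> real n * e"
      using e by (intro vnorm_le_coordinate_bound) (simp add: d_def)
    finally show "body_norm x \<le> body_norm y + C * real n * e"
      using C(1) by (simp add: mult.assoc)
  qed
qed

lemma body_norm_grid:
  obtains C where "0 < C"
    "\<And>k \<xi>. \<xi> \<in> space \<sigma> \<Longrightarrow> \<bar>body_norm (grid n k \<xi>) - body_norm \<xi>\<bar> \<le> C / real (Suc k)"
proof -
  obtain C where C: "0 < C"
    "\<And>x y e. x \<in> Rn n \<Longrightarrow> y \<in> Rn n \<Longrightarrow> (\<And>i. i < n \<Longrightarrow> \<bar>x i - y i\<bar> \<le> e) \<Longrightarrow> body_norm x \<le> body_norm y + C * e"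
    by (rule body_norm_lipschitz) blast
  show thesis
  proof (rule that[OF C(1)])
    fix k \<xi> assume "\<xi> \<in> space \<sigma>"
    then have \<xi>: "\<xi> \<in> Rn n" by (rule sphere_subset_Rn)
    have "body_norm (grid n k \<xi>) \<le> body_norm \<xi> + C * (1 / real (Suc k))"
      by (rule C(2)[OF grid_in_Rn \<xi>]) (rule grid_near)
    moreover have "body_norm \<xi> \<le> body_norm (grid n k \<xi>) + C * (1 / real (Suc k))"
      by (rule C(2)[OF \<xi> grid_in_Rn]) (subst abs_minus_commute, rule grid_near)
    ultimately show "\<bar>body_norm (grid n k \<xi>) - body_norm \<xi>\<bar> \<le> C / real (Suc k)" by auto
  qed
qed

text \<open>
  Measurability comes from the grid: the gauge is the pointwise limit of its values at grid points, which
  take finitely many values.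
\<close>

lemma integrable_body_norm: "integrable \<sigma> body_norm"
proof -
  obtain C where C: "\<And>k \<xi>. \<xi> \<in> space \<sigma> \<Longrightarrow> \<bar>body_norm (grid n k \<xi>) - body_norm \<xi>\<bar> \<le> C / real (Suc k)"
    by (rule body_norm_grid) blast
  obtain C' where C': "0 < C'" "\<And>x. x \<in> Rn n \<Longrightarrow> body_norm x \<le> C' * vnorm n x"
    by (rule body_norm_le_norm) blast
  have "body_norm \<in> borel_measurable \<sigma>"
  proof (rule borel_measurable_LIMSEQ_real)
    show "(\<lambda>\<xi>. body_norm (grid n k \<xi>)) \<in> borel_measurable \<sigma>" for k
      using integral_grid_sphere(1) by (rule borel_measurable_integrable)
    fix \<xi> assume "\<xi> \<in> space \<sigma>"
    then have "\<forall>k. norm (body_norm (grid n k \<xi>) - body_norm \<xi>) \<le> C / real (Suc k)"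
      using C by simp
    then have "(\<lambda>k. body_norm (grid n k \<xi>) - body_norm \<xi>) \<longlonglongrightarrow> 0"
      by (rule Lim_null_comparison[OF always_eventually tendsto_const_over_Suc])
    then show "(\<lambda>k. body_norm (grid n k \<xi>)) \<longlonglongrightarrow> body_norm \<xi>"
      by (simp add: LIM_zero_iff)
  qed
  then show ?thesis
  proof (rule integrable_bounded[where B = C'])
    fix \<xi> assume \<xi>: "\<xi> \<in> space \<sigma>"
    then have "vnorm n \<xi> = 1" by (simp add: space_sphere unit_sphere_def)
    with C'(2)[OF sphere_subset_Rn[OF \<xi>]] body_norm_nonneg[OF sphere_subset_Rn[OF \<xi>]]
    show "\<bar>body_norm \<xi>\<bar> \<le> C'" by simp
  qed
qed

text \<open>
  \<open>K\<close> is bounded, so its gauge is bounded away from \<open>0\<close> on the sphere. Positivity makes the quotient in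
  \<open>p_ratio\<close> a genuine one.
\<close>

lemma mean_norm_pos: "0 < mean_norm n \<sigma> K"
proof -
  obtain R where R: "0 < R" "\<And>x i. x \<in> K \<Longrightarrow> i < n \<Longrightarrow> \<bar>x i\<bar> \<le> R"
    using compactin_bounded[OF compact] by metis
  have n: "0 < real n" using dim by simp
  have "1 / (real n * R) \<le> body_norm \<xi>" if \<xi>: "\<xi> \<in> space \<sigma>" for \<xi>
  proof (rule body_norm_greatest[OF sphere_subset_Rn[OF \<xi>]])
    fix s assume s: "0 \<le> s" "\<xi> \<in> vscale n s ` K"
    then obtain x where x: "x \<in> K" "\<xi> = vscale n s x" by auto
    have "1 = vnorm n \<xi>" using \<xi> by (simp add: space_sphere unit_sphere_def)
    also have "\<dots> = s * vnorm n x" using s by (simp add: x(2) vnorm_vscale)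
    also have "\<dots> \<le> s * (real n * R)"
      using R(2)[OF x(1)] s(1) by (intro mult_left_mono vnorm_le_coordinate_bound)
    finally show "1 / (real n * R) \<le> s" using R(1) n by (simp add: divide_le_eq)
  qed
  then have "(LINT \<xi>|\<sigma>. 1 / (real n * R)) \<le> (LINT \<xi>|\<sigma>. body_norm \<xi>)"
    by (intro integral_mono integrable_body_norm) auto
  then have "1 / (real n * R) \<le> mean_norm n \<sigma> K"
    by (simp add: prob_space mean_norm_def)
  moreover have "0 < 1 / (real n * R)" using R(1) n by simp
  ultimately show ?thesis by linarith
qed

lemma inner_grid_moment:
  "(LINT \<xi>|\<sigma>. \<bar>\<Sum>i<n. grid n k \<xi> i * y i\<bar>) \<le> vnorm n y * (1 / sqrt (real n) + real n / real (Suc k))"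
proof -
  have pt: "\<bar>\<Sum>i<n. grid n k \<xi> i * y i\<bar> \<le> \<bar>\<Sum>i<n. \<xi> i * y i\<bar> + real n / real (Suc k) * vnorm n y" for \<xi>
  proof -
    have "(\<Sum>i<n. grid n k \<xi> i * y i) = (\<Sum>i<n. \<xi> i * y i) + (\<Sum>i<n. (grid n k \<xi> i - \<xi> i) * y i)"
      by (simp add: sum.distrib[symmetric] algebra_simps)
    moreover have "\<bar>\<Sum>i<n. (grid n k \<xi> i - \<xi> i) * y i\<bar> \<le> real n / real (Suc k) * vnorm n y"
    proof -
      have "\<bar>\<Sum>i<n. (grid n k \<xi> i - \<xi> i) * y i\<bar> \<le> (\<Sum>i<n. \<bar>(grid n k \<xi> i - \<xi> i) * y i\<bar>)"
        by (rule sum_abs)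
      also have "\<dots> \<le> (\<Sum>i<n. 1 / real (Suc k) * vnorm n y)"
        unfolding abs_mult by (intro sum_mono mult_mono grid_near abs_coordinate_le_vnorm) auto
      finally show ?thesis by simp
    qed
    ultimately show ?thesis by linarith
  qed
  have "(LINT \<xi>|\<sigma>. \<bar>\<Sum>i<n. grid n k \<xi> i * y i\<bar>) \<le> (LINT \<xi>|\<sigma>. \<bar>\<Sum>i<n. \<xi> i * y i\<bar> + real n / real (Suc k) * vnorm n y)"
    using pt integrable_linear
    by (intro integral_mono integral_grid_sphere(1)[of "\<lambda>v. \<bar>\<Sum>i<n. v i * y i\<bar>"] Bochner_Integration.integrable_add integrable_abs) auto
  also have "\<dots> = (LINT \<xi>|\<sigma>. \<bar>\<Sum>i<n. \<xi> i * y i\<bar>) + real n / real (Suc k) * vnorm n y"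
    using integrable_linear by (simp add: prob_space)
  also have "\<dots> \<le> vnorm n y / sqrt (real n) + real n / real (Suc k) * vnorm n y"
    using first_moment_linear by simp
  finally show ?thesis by (simp add: algebra_simps)
qed

text \<open>
  The segments are \<open>[0, c v v]\<close>, one for each grid value \<open>v\<close> on the sphere, with \<open>c v\<close> proportional to
  the \<open>\<sigma>\<close>-measure of its cell. Subtracting the centre \<open>b\<close> of the zonotope leaves symmetric segments;
  a point \<open>d\<close> of the centred zonotope satisfies
  \<open>\<langle>d, d\<rangle> \<le> t \<surd>n \<integral> \<bar>\<langle>\<xi>, d\<rangle>\<bar> d\<sigma>\<close> up to the grid error, and the right-hand side is at most \<open>t |d|\<close>.
\<close>

lemma discrete_parallel_volume:
  assumes t: "0 < t"
  shows "vol n K * (1 + t * sqrt (real n) * (LINT \<xi>|\<sigma>. body_norm (grid n k \<xi>)))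
    \<le> vol n (outer_parallel n K (t * (1 + real n * sqrt (real n) / real (Suc k))))"
proof -
  define V where "V = grid n k ` space \<sigma>"
  define w where "w v = measure \<sigma> {\<xi> \<in> space \<sigma>. grid n k \<xi> = v}" for v
  define c where "c v = 2 * t * sqrt (real n) * w v" for v
  define \<eta> where "\<eta> = 1 + real n * sqrt (real n) / real (Suc k)"
  have \<eta>: "0 < t * \<eta>" using t by (simp add: \<eta>_def add_pos_nonneg)
  have w0: "0 \<le> w v" for v by (simp add: w_def)
  have c0: "0 \<le> c v" for v using w0 t by (simp add: c_def)
  have VR: "v \<in> Rn n" if "v \<in> V" for v using that grid_in_Rn by (auto simp: V_def)
  have finV: "finite V" unfolding V_def by (rule finite_grid_sphere)
  obtain L where L: "compactin (Rn_top n) L"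
    "vol n K + (\<Sum>v\<in>V. growth n K (vscale n (c v) v) 1) \<le> vol n L"
    "\<And>z. z \<in> L \<Longrightarrow> \<exists>x\<in>K. \<exists>s. (\<forall>v\<in>V. 0 \<le> s v \<and> s v \<le> 1) \<and> z = (\<lambda>i\<in>{..<n}. x i + (\<Sum>v\<in>V. s v * vscale n (c v) v i))"
    by (rule zonotope_growth[OF compact convex finV, of "\<lambda>v. vscale n (c v) v"]) blast
  have "vol n K * (1 + t * sqrt (real n) * (LINT \<xi>|\<sigma>. body_norm (grid n k \<xi>)))
      = vol n K + (\<Sum>v\<in>V. vol n K * (c v * body_norm v) / 2)"
    unfolding integral_grid_sphere(2) V_def[symmetric] w_def[symmetric]
    by (simp add: c_def sum_distrib_left algebra_simps)
  also have "\<dots> \<le> vol n K + (\<Sum>v\<in>V. growth n K (vscale n (c v) v) 1)"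
  proof (intro add_left_mono sum_mono)
    fix v assume "v \<in> V"
    then have "vol n K * (c v * body_norm v) = vol n K * body_norm (vscale n (c v) v)"
      using body_norm_vscale[OF VR c0] by simp
    also have "\<dots> \<le> 2 * growth n K (vscale n (c v) v) 1"
      by (rule body_norm_growth[OF vscale_in_Rn])
    finally show "vol n K * (c v * body_norm v) / 2 \<le> growth n K (vscale n (c v) v) 1" by simp
  qed
  also have "\<dots> \<le> vol n L" by (rule L(2))
  also have "\<dots> \<le> vol n (outer_parallel n K (t * \<eta>))"
  proof -
    define b where "b = (\<lambda>i\<in>{..<n}. \<Sum>v\<in>V. 1 / 2 * vscale n (c v) v i)"
    have "{z \<in> Rn n. slide n z 1 b \<in> L} \<subseteq> outer_parallel n K (t * \<eta>)"
    proof
      fix z assume "z \<in> {z \<in> Rn n. slide n z 1 b \<in> L}"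
      then have z: "z \<in> Rn n" "slide n z 1 b \<in> L" by auto
      from L(3)[OF z(2)] obtain x s where x: "x \<in> K" and s: "\<forall>v\<in>V. 0 \<le> s v \<and> s v \<le> 1"
        and zx: "slide n z 1 b = (\<lambda>i\<in>{..<n}. x i + (\<Sum>v\<in>V. s v * vscale n (c v) v i))"
        by blast
      \<comment> \<open>shifting the parameters \<open>s v\<close> from \<open>[0, 1]\<close> to \<open>[-1, 1]\<close> halves \<open>c v\<close>\<close>
      define d where "d = (\<lambda>i\<in>{..<n}. \<Sum>v\<in>V. (2 * s v - 1) * (t * sqrt (real n) * w v) * v i)"
      have zd: "z = vadd n x d"
      proof
        fix i show "z i = vadd n x d i"
        proof (cases "i < n")
          case True
          have "z i + b i = x i + (\<Sum>v\<in>V. s v * vscale n (c v) v i)"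
            using fun_cong[OF zx, of i] True by (simp add: slide_def)
          then have "z i = x i + ((\<Sum>v\<in>V. s v * vscale n (c v) v i) - (\<Sum>v\<in>V. 1 / 2 * vscale n (c v) v i))"
            using True by (simp add: b_def)
          also have "(\<Sum>v\<in>V. s v * vscale n (c v) v i) - (\<Sum>v\<in>V. 1 / 2 * vscale n (c v) v i) = d i"
            unfolding d_def sum_subtractf[symmetric] using True
            by (simp add: vscale_def c_def) (intro sum.cong refl, simp add: algebra_simps)
          finally show ?thesis using True by (simp add: vadd_def)
        qed (use z(1) in \<open>auto simp: vadd_def PiE_iff extensional_def\<close>)
      qed
      have "(vnorm n d)\<^sup>2 \<le> vnorm n d * (t * \<eta>)"
      proof -
        have "(vnorm n d)\<^sup>2 = (\<Sum>i<n. d i * d i)"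
          by (simp add: vnorm_def L2_set_def sum_nonneg power2_eq_square)
        also have "\<dots> = (\<Sum>i<n. \<Sum>v\<in>V. (2 * s v - 1) * (t * sqrt (real n) * w v) * (v i * d i))"
          by (intro sum.cong refl) (simp add: d_def sum_distrib_right mult.assoc)
        also have "\<dots> = (\<Sum>v\<in>V. \<Sum>i<n. (2 * s v - 1) * (t * sqrt (real n) * w v) * (v i * d i))"
          by (rule sum.swap)
        also have "\<dots> = (\<Sum>v\<in>V. (2 * s v - 1) * (t * sqrt (real n) * w v) * (\<Sum>i<n. v i * d i))"
          by (simp add: sum_distrib_left)
        also have "\<dots> \<le> (\<Sum>v\<in>V. t * sqrt (real n) * (w v * \<bar>\<Sum>i<n. v i * d i\<bar>))"
        proof (intro sum_mono)
          fix v assume v: "v \<in> V"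
          have "(2 * s v - 1) * (t * sqrt (real n) * w v) * (\<Sum>i<n. v i * d i)
              \<le> \<bar>(2 * s v - 1) * (t * sqrt (real n) * w v) * (\<Sum>i<n. v i * d i)\<bar>" by (rule abs_ge_self)
          also have "\<dots> = \<bar>2 * s v - 1\<bar> * (t * sqrt (real n) * w v * \<bar>\<Sum>i<n. v i * d i\<bar>)"
            using t w0 by (simp add: abs_mult)
          also have "\<dots> \<le> 1 * (t * sqrt (real n) * w v * \<bar>\<Sum>i<n. v i * d i\<bar>)"
            using s v t w0 by (intro mult_right_mono) (auto simp: abs_le_iff)
          finally show "(2 * s v - 1) * (t * sqrt (real n) * w v) * (\<Sum>i<n. v i * d i)
              \<le> t * sqrt (real n) * (w v * \<bar>\<Sum>i<n. v i * d i\<bar>)" by (simp add: mult.assoc)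
        qed
        also have "\<dots> = t * sqrt (real n) * (LINT \<xi>|\<sigma>. \<bar>\<Sum>i<n. grid n k \<xi> i * d i\<bar>)"
          unfolding integral_grid_sphere(2)[of "\<lambda>v. \<bar>\<Sum>i<n. v i * d i\<bar>" k] V_def w_def
          by (simp add: sum_distrib_left)
        also have "\<dots> \<le> t * sqrt (real n) * (vnorm n d * (1 / sqrt (real n) + real n / real (Suc k)))"
          using t by (intro mult_left_mono inner_grid_moment) auto
        also have "\<dots> = vnorm n d * (t * \<eta>)"
        proof -
          have "sqrt (real n) * (1 / sqrt (real n) + real n / real (Suc k)) = \<eta>"
            using dim by (simp add: \<eta>_def distrib_left mult.commute)
          then show ?thesis by (metis mult.assoc mult.commute)
        qed
        finally show ?thesis .
      qed
      then have dn: "vnorm n d \<le> t * \<eta>"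
        using \<eta> vnorm_nonneg[of n d] by (cases "vnorm n d = 0") (auto simp: power2_eq_square)
      have "d \<in> Rn n" by (simp add: d_def)
      then have "d = vscale n (t * \<eta>) (vscale n (1 / (t * \<eta>)) d)"
      proof -
        have "t * \<eta> * (1 / (t * \<eta>)) = 1" using less_imp_neq[OF \<eta>] by (metis times_divide_eq_right mult_1_right divide_self)
        then show ?thesis using \<open>d \<in> Rn n\<close> by (simp only: vscale_vscale vscale_1)
      qed
      moreover have "vscale n (1 / (t * \<eta>)) d \<in> unit_ball n"
      proof -
        have "\<bar>1 / (t * \<eta>)\<bar> = 1 / (t * \<eta>)" using \<eta> by (intro abs_of_pos) simp
        then have "vnorm n (vscale n (1 / (t * \<eta>)) d) = vnorm n d / (t * \<eta>)" by (simp add: vnorm_vscale)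
        also have "\<dots> \<le> 1" using dn by (simp only: divide_le_eq_1_pos[OF \<eta>])
        finally show ?thesis by (simp add: unit_ball_def vscale_in_Rn)
      qed
      ultimately obtain y where y: "y \<in> unit_ball n" "d = vscale n (t * \<eta>) y" by metis
      show "z \<in> outer_parallel n K (t * \<eta>)"
        unfolding outer_parallel_def zd y(2) using x y(1) by blast
    qed
    moreover have "{z \<in> Rn n. slide n z 1 b \<in> L} = (\<lambda>z. slide n z 1 b) -` L \<inter> space (Rn_leb n)"
      by (auto simp: space_PiM)
    then have "{z \<in> Rn n. slide n z 1 b \<in> L} \<in> sets (Rn_leb n)"
      by (simp only: measurable_sets[OF measurable_slide compactin_measurable[OF L(1)]])
    ultimately have "vol n {z \<in> Rn n. slide n z 1 b \<in> L} \<le> vol n (outer_parallel n K (t * \<eta>))"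
      by (intro vol_mono compactin_outer_parallel compact)
    then show ?thesis
      by (simp only: vol_slide[OF compactin_measurable[OF L(1)]])
  qed
  finally show ?thesis by (simp only: \<eta>_def)
qed

text \<open>
  Apply the discrete estimate with \<open>t\<close> divided by the factor \<open>h k\<close> that the grid costs, and let
  \<open>k\<close> tend to infinity.
\<close>

proposition parallel_volume_growth:
  assumes t: "0 < t"
  shows "sqrt (real n) * vol n K * mean_norm n \<sigma> K \<le> (vol n (outer_parallel n K t) - vol n K) / t"
proof -
  obtain C where C: "\<And>k \<xi>. \<xi> \<in> space \<sigma> \<Longrightarrow> \<bar>body_norm (grid n k \<xi>) - body_norm \<xi>\<bar> \<le> C / real (Suc k)"
    by (rule body_norm_grid) blast
  define I where "I k = (LINT \<xi>|\<sigma>. body_norm (grid n k \<xi>))" for k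
  define h where "h k = 1 + real n * sqrt (real n) / real (Suc k)" for k
  have h: "0 < h k" for k by (simp add: h_def add_pos_nonneg)
  have I: "mean_norm n \<sigma> K - C / real (Suc k) \<le> I k" for k
  proof -
    have "(LINT \<xi>|\<sigma>. body_norm \<xi> - C / real (Suc k)) \<le> I k"
      unfolding I_def
    proof (intro integral_mono integral_grid_sphere Bochner_Integration.integrable_diff integrable_body_norm)
      fix \<xi> assume "\<xi> \<in> space \<sigma>"
      from C[OF this, of k] show "body_norm \<xi> - C / real (Suc k) \<le> body_norm (grid n k \<xi>)" by linarith
    qed
    then show ?thesis
      using integrable_body_norm by (simp add: mean_norm_def prob_space)
  qed
  have *: "sqrt (real n) * vol n K * (mean_norm n \<sigma> K - C / real (Suc k)) \<le> (vol n (outer_parallel n K t) - vol n K) / t * h k" for k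
  proof -
    have "vol n K * (1 + t / h k * sqrt (real n) * I k) \<le> vol n (outer_parallel n K (t / h k * h k))"
      unfolding I_def h_def[of k, symmetric]
      using discrete_parallel_volume[of "t / h k" k] t h[of k] unfolding h_def[of k, symmetric] by simp
    also have "t / h k * h k = t" using h[of k] by simp
    finally have "t / h k * (sqrt (real n) * vol n K * I k) \<le> vol n (outer_parallel n K t) - vol n K"
      by (simp add: algebra_simps)
    then have "sqrt (real n) * vol n K * I k \<le> (vol n (outer_parallel n K t) - vol n K) / t * h k"
      using t h[of k] by (simp add: field_simps)
    moreover have "sqrt (real n) * vol n K * (mean_norm n \<sigma> K - C / real (Suc k)) \<le> sqrt (real n) * vol n K * I k"
      using vol_pos I by (intro mult_left_mono) auto
    ultimately show ?thesis by linarith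
  qed
  have l1: "(\<lambda>k. sqrt (real n) * vol n K * (mean_norm n \<sigma> K - C / real (Suc k))) \<longlonglongrightarrow> sqrt (real n) * vol n K * (mean_norm n \<sigma> K - 0)"
    by (intro tendsto_intros tendsto_const_over_Suc)
  have l2: "(\<lambda>k. (vol n (outer_parallel n K t) - vol n K) / t * h k) \<longlonglongrightarrow> (vol n (outer_parallel n K t) - vol n K) / t * (1 + 0)"
    unfolding h_def by (intro tendsto_intros tendsto_const_over_Suc)
  show ?thesis
    using LIMSEQ_le[OF l1 l2] * by simp
qed

theorem surface_area_ge: "sqrt (real n) * vol n K * mean_norm n \<sigma> K \<le> surface_area n K"
proof -
  obtain b \<delta> where "0 < \<delta>" "\<And>t. 0 < t \<Longrightarrow> t \<le> \<delta> \<Longrightarrow> (vol n (outer_parallel n K t) - vol n K) / t \<le> b"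
    by (rule outer_parallel_volume_bound) blast
  then show ?thesis
    by (intro surface_area_bounds(1)[of \<delta>]) (auto intro: parallel_volume_growth)
qed

end

section \<open>Slabs and the upper bound\<close>

lemma convex_body_iff:
  "convex_body n K \<longleftrightarrow> compactin (Rn_top n) K \<and> convex_in n K \<and> Rn_top n interior_of K \<noteq> {}"
  by (simp add: convex_body_def convex_in_def)

lemma centered_if_symmetric:
  assumes K: "compactin (Rn_top n) K" and sym: "centrally_symmetric n K"
  shows "centered n K"
proof -
  have KM: "K \<in> sets (Rn_leb n)" by (rule compactin_measurable[OF K])
  have "(LINT x:K|Rn_leb n. x i) = 0" if i: "i < n" for i
  proof -
    let ?N = "\<lambda>x. \<lambda>i\<in>{..<n}. (-1) * x i + (0::real)"
    let ?g = "\<lambda>x. indicator K x *\<^sub>R x i"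
    have N: "?N x = vscale n (- 1) x" for x by (simp add: vscale_def)
    have inv: "x \<in> K \<longleftrightarrow> ?N x \<in> K" if x: "x \<in> Rn n" for x
    proof
      show "?N x \<in> K" if "x \<in> K" using sym that unfolding N centrally_symmetric_def by blast
      assume "?N x \<in> K"
      then have "vscale n (- 1) (vscale n (- 1) x) \<in> K"
        using sym unfolding N centrally_symmetric_def by blast
      then show "x \<in> K" using x by (simp add: vscale_vscale vscale_1)
    qed
    have "distr (Rn_leb n) (Rn_leb n) ?N = Rn_leb n"
      using Rn_leb_affine[of "-1" n "\<lambda>_. 0"] by simp
    then have "(LINT x|Rn_leb n. ?g x) = (LINT x|distr (Rn_leb n) (Rn_leb n) ?N. ?g x)"
      by simp
    also have "\<dots> = (LINT x|Rn_leb n. ?g (?N x))"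
      using KM i by (intro integral_distr measurable_affine borel_measurable_scaleR borel_measurable_indicator measurable_coordinate)
    also have "\<dots> = (LINT x|Rn_leb n. - ?g x)"
    proof (intro Bochner_Integration.integral_cong refl)
      fix x assume "x \<in> space (Rn_leb n)"
      then have "x \<in> Rn n" by (simp add: space_PiM)
      from inv[OF this] show "?g (?N x) = - ?g x" using i by (simp add: indicator_def)
    qed
    finally show ?thesis by (simp add: set_lebesgue_integral_def)
  qed
  then show ?thesis
    unfolding centered_def barycenter_def by (intro restrict_ext) simp
qed

lemma centered_bodyI: "convex_body n K \<Longrightarrow> centered n K \<Longrightarrow> centered_body n K"
  by (simp add: convex_body_iff centered_body_def vol_pos_if_interior)

text \<open>
  Half the edge lengths. Long edges in all directions but one make the isoperimetric quotient
  \<open>S / |K| = \<Sum> 1 / a\<^sub>i\<close> bounded, while the single short edge keeps the mean gauge at the order of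
  \<open>1 / \<surd>n\<close>.
\<close>

definition slab_side :: "nat \<Rightarrow> nat \<Rightarrow> real" where
  "slab_side n i = (if i = 0 then 1 else real n)"

definition slab :: "nat \<Rightarrow> (nat \<Rightarrow> real) set" where
  "slab n = (\<Pi>\<^sub>E i\<in>{..<n}. {- slab_side n i..slab_side n i})"

lemma slab_side_pos: "i < n \<Longrightarrow> 0 < slab_side n i"
  by (auto simp: slab_side_def)

lemma convex_body_slab: "convex_body n (slab n)"
  unfolding convex_body_iff
proof (intro conjI)
  show "compactin (Rn_top n) (slab n)"
    by (auto simp: slab_def compactin_PiE)
  show "convex_in n (slab n)"
    unfolding convex_in_def
  proof (intro ballI)
    fix x y u assume x: "x \<in> slab n" and y: "y \<in> slab n" and u: "u \<in> {0..1::real}"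
    have "(1 - u) * x i + u * y i \<in> {- slab_side n i..slab_side n i}" if i: "i < n" for i
    proof -
      have "x i \<in> {- slab_side n i..slab_side n i}" "y i \<in> {- slab_side n i..slab_side n i}"
        using x y i unfolding slab_def by blast+
      then show ?thesis
        using u convexD[OF convex_real_interval(5)[of "- slab_side n i" "slab_side n i"], of "x i" "y i" "1 - u" u] by simp
    qed
    then show "vadd n (vscale n (1 - u) x) (vscale n u y) \<in> slab n"
      unfolding slab_def vadd_def vscale_def by (intro restrict_PiE_iff[THEN iffD2] ballI) simp
  qed
  let ?U = "\<Pi>\<^sub>E i\<in>{..<n}. {- slab_side n i<..<slab_side n i}"
  have "openin (Rn_top n) ?U"
    by (auto simp: openin_PiE)
  moreover have "?U \<subseteq> slab n"
    unfolding slab_def by (intro PiE_mono) auto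
  ultimately have "?U \<subseteq> Rn_top n interior_of slab n"
    by (intro interior_of_maximal)
  moreover have "origin n \<in> ?U"
    by (intro restrict_PiE_iff[THEN iffD2] ballI) (simp add: slab_side_pos)
  ultimately show "Rn_top n interior_of slab n \<noteq> {}" by blast
qed

lemma centrally_symmetric_slab: "centrally_symmetric n (slab n)"
  unfolding centrally_symmetric_def
proof
  fix x assume x: "x \<in> slab n"
  have "- 1 * x i \<in> {- slab_side n i..slab_side n i}" if i: "i < n" for i
  proof -
    have "x i \<in> {- slab_side n i..slab_side n i}"
      using x i unfolding slab_def by blast
    then show ?thesis by simp
  qed
  then show "vscale n (- 1) x \<in> slab n"
    unfolding slab_def vscale_def by (intro restrict_PiE_iff[THEN iffD2] ballI) simp
qed

lemma centered_slab: "centered n (slab n)"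
  using convex_body_slab centrally_symmetric_slab centered_if_symmetric convex_body_iff by blast

text \<open>
  The parallel body lies in the box with half edges \<open>a\<^sub>i + t\<close>. For \<open>t \<le> 1 / 2\<close> the volume grows by a
  factor
  \<open>\<Prod> (1 + t / a\<^sub>i) \<le> exp (\<Sum> t / a\<^sub>i) \<le> exp (2 t) \<le> 1 + 4 t\<close>.
\<close>

lemma vol_outer_parallel_slab:
  assumes t: "0 < t" "t \<le> 1 / 2"
  shows "(vol n (outer_parallel n (slab n) t) - vol n (slab n)) / t \<le> 4 * vol n (slab n)"
proof -
  let ?a = "slab_side n"
  let ?D = "\<Pi>\<^sub>E i\<in>{..<n}. {- (?a i + t)..?a i + t}"
  have "outer_parallel n (slab n) t \<subseteq> ?D"
  proof
    fix z assume "z \<in> outer_parallel n (slab n) t"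
    then obtain x y where z: "z = vadd n x (vscale n t y)" "x \<in> slab n" "y \<in> unit_ball n"
      by (auto simp: outer_parallel_def)
    have "x i + t * y i \<in> {- (?a i + t)..?a i + t}" if i: "i < n" for i
    proof -
      have "x i \<in> {- ?a i..?a i}" using z(2) i unfolding slab_def by blast
      moreover have "\<bar>y i\<bar> \<le> 1"
        using abs_coordinate_le_vnorm[OF i, of y] z(3) by (simp add: unit_ball_def)
      then have "\<bar>t * y i\<bar> \<le> t" using t by (simp add: abs_mult mult_left_le)
      ultimately show ?thesis by (auto simp: abs_le_iff)
    qed
    then show "z \<in> ?D"
      unfolding z(1) vadd_def vscale_def by (intro restrict_PiE_iff[THEN iffD2] ballI) simp
  qed
  then have "vol n (outer_parallel n (slab n) t) \<le> vol n ?D"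
    using convex_body_slab[of n] compactin_measurable[OF compactin_outer_parallel]
    by (intro vol_mono) (auto simp: compactin_PiE convex_body_iff)
  also have "\<dots> = (\<Prod>i<n. 2 * (?a i + t))"
    using t slab_side_pos[of _ n] by (subst vol_box) (auto simp: less_imp_le add_nonneg_nonneg algebra_simps intro!: prod.cong)
  also have "\<dots> \<le> (\<Prod>i<n. 2 * ?a i * exp (t / ?a i))"
  proof (intro prod_mono conjI)
    fix i assume "i \<in> {..<n}"
    then have a: "0 < ?a i" by (simp add: slab_side_pos)
    show "0 \<le> 2 * (?a i + t)" using a t by simp
    have "2 * (?a i + t) = 2 * ?a i * (1 + t / ?a i)" using a by (simp add: field_simps)
    also have "\<dots> \<le> 2 * ?a i * exp (t / ?a i)" using a by (intro mult_left_mono) auto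
    finally show "2 * (?a i + t) \<le> 2 * ?a i * exp (t / ?a i)" .
  qed
  also have "\<dots> = vol n (slab n) * exp (\<Sum>i<n. t / ?a i)"
  proof -
    have "vol n (slab n) = (\<Prod>i<n. 2 * ?a i)"
      unfolding slab_def using slab_side_pos[of _ n] by (subst vol_box) (auto simp: less_imp_le intro!: prod.cong)
    then show ?thesis by (simp add: prod.distrib exp_sum)
  qed
  also have "\<dots> \<le> vol n (slab n) * (1 + 4 * t)"
  proof (intro mult_left_mono)
    have "(\<Sum>i<n. t / ?a i) \<le> 2 * t"
    proof (cases n)
      case (Suc m)
      have "(\<Sum>i<n. t / ?a i) = t + (\<Sum>i<m. t / real n)"
        unfolding Suc sum.lessThan_Suc_shift by (simp add: slab_side_def)
      also have "\<dots> \<le> t + t" using t by (simp add: Suc divide_simps)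
      finally show ?thesis by simp
    qed (use t in simp)
    then have "exp (\<Sum>i<n. t / ?a i) \<le> exp (2 * t)" by simp
    also have "\<dots> \<le> 1 + 2 * t + (2 * t)\<^sup>2"
      using t by (intro exp_bound) auto
    also have "(2 * t)\<^sup>2 \<le> 2 * t"
      using t by (simp add: power2_eq_square)
    finally show "exp (\<Sum>i<n. t / ?a i) \<le> 1 + 4 * t" by simp
    show "0 \<le> vol n (slab n)" by (simp add: vol_def)
  qed
  finally show ?thesis using t by (simp add: divide_le_eq algebra_simps)
qed

lemma p_ratio_ge:
  assumes n: "2 \<le> n" and \<sigma>: "rotation_invariant_prob n \<sigma>" and K: "convex_body n K" "centered n K"
  shows "sqrt (real n) \<le> p_ratio n \<sigma> K"
proof -
  interpret centered_body_sphere n K \<sigma>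
    using centered_bodyI[OF K] n \<sigma> by (simp add: centered_body_sphere_def sphere_measure_def)
  have "0 < vol n K * mean_norm n \<sigma> K" using vol_pos mean_norm_pos by simp
  then show ?thesis
    using surface_area_ge by (simp add: p_ratio_def le_divide_eq mult.assoc)
qed

lemma p_ratio_slab:
  assumes n: "2 \<le> n" and \<sigma>: "rotation_invariant_prob n \<sigma>"
  shows "p_ratio n \<sigma> (slab n) \<le> 36 / 5 * sqrt (real n)"
proof -
  interpret centered_body_sphere n "slab n" \<sigma>
    using centered_bodyI[OF convex_body_slab centered_slab] n \<sigma>
    by (simp add: centered_body_sphere_def sphere_measure_def)
  have S: "surface_area n (slab n) \<le> 4 * vol n (slab n)"
    by (rule surface_area_bounds(2)[where \<delta> = "1 / 2", OF _ parallel_volume_growth vol_outer_parallel_slab]) auto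
  have "\<bar>\<xi> 0\<bar> \<le> body_norm \<xi>" if \<xi>: "\<xi> \<in> space \<sigma>" for \<xi>
  proof (rule body_norm_greatest[OF sphere_subset_Rn[OF \<xi>]])
    fix s assume s: "0 \<le> s" "\<xi> \<in> vscale n s ` slab n"
    then obtain x where x: "x \<in> slab n" "\<xi> = vscale n s x" by auto
    have "0 \<in> {..<n}" using n by simp
    from PiE_mem[OF x(1)[unfolded slab_def] this] have "\<bar>x 0\<bar> \<le> 1" by (auto simp: slab_side_def)
    then show "\<bar>\<xi> 0\<bar> \<le> s" using s(1) n by (simp add: x(2) vscale_def abs_mult mult_left_le)
  qed
  then have "(LINT \<xi>|\<sigma>. \<bar>\<xi> 0\<bar>) \<le> mean_norm n \<sigma> (slab n)"
    unfolding mean_norm_def using n integrable_power[of 0 1]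
    by (intro integral_mono integrable_body_norm integrable_abs) auto
  moreover have "5 / (9 * sqrt (real n)) \<le> (LINT \<xi>|\<sigma>. \<bar>\<xi> 0\<bar>)"
    using n by (intro first_absolute_moment_ge) auto
  ultimately have M: "5 / (9 * sqrt (real n)) \<le> mean_norm n \<sigma> (slab n)" by linarith
  have sq: "0 < sqrt (real n)" using n by simp
  have "4 \<le> 36 / 5 * sqrt (real n) * mean_norm n \<sigma> (slab n)"
  proof -
    have "4 = 36 / 5 * sqrt (real n) * (5 / (9 * sqrt (real n)))" using sq by simp
    also have "\<dots> \<le> 36 / 5 * sqrt (real n) * mean_norm n \<sigma> (slab n)"
      using sq M by (intro mult_left_mono) auto
    finally show ?thesis .
  qed
  then have "4 * vol n (slab n) \<le> 36 / 5 * sqrt (real n) * mean_norm n \<sigma> (slab n) * vol n (slab n)"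
    using vol_pos by (intro mult_right_mono) auto
  with S have "surface_area n (slab n) \<le> 36 / 5 * sqrt (real n) * (vol n (slab n) * mean_norm n \<sigma> (slab n))"
    by (simp add: mult_ac)
  then show ?thesis
    using vol_pos mean_norm_pos by (simp add: p_ratio_def divide_le_eq)
qed

theorem theorem6p3:
  "(\<forall>n\<ge>2. \<forall>\<sigma>. rotation_invariant_prob n \<sigma> \<longrightarrow>
      (\<forall>K. convex_body n K \<and> centrally_symmetric n K \<longrightarrow>
         surface_area n K \<ge> sqrt (real n) * vol n K * mean_norm n \<sigma> K)) \<and>
   (\<exists>c1>0. \<exists>c2>0. \<forall>n\<ge>2. \<forall>\<sigma>. rotation_invariant_prob n \<sigma> \<longrightarrow>
      c1 * Inf {p_ratio n \<sigma> K | K. convex_body n K \<and> centered n K} \<le> sqrt (real n) \<and>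
      sqrt (real n) \<le> c2 * Inf {p_ratio n \<sigma> K | K. convex_body n K \<and> centered n K})"
proof (intro conjI)
  show "\<forall>n\<ge>2. \<forall>\<sigma>. rotation_invariant_prob n \<sigma> \<longrightarrow>
      (\<forall>K. convex_body n K \<and> centrally_symmetric n K \<longrightarrow>
         surface_area n K \<ge> sqrt (real n) * vol n K * mean_norm n \<sigma> K)"
  proof (intro allI impI)
    fix n \<sigma> K
    assume n: "2 \<le> n" and \<sigma>: "rotation_invariant_prob n \<sigma>" and K: "convex_body n K \<and> centrally_symmetric n K"
    then have "centered_body n K"
      by (intro centered_bodyI centered_if_symmetric) (auto simp: convex_body_iff)
    then interpret centered_body_sphere n K \<sigma>
      using n \<sigma> by (simp add: centered_body_sphere_def sphere_measure_def)
    show "surface_area n K \<ge> sqrt (real n) * vol n K * mean_norm n \<sigma> K"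
      by (rule surface_area_ge)
  qed
  have "5 / 36 * Inf {p_ratio n \<sigma> K | K. convex_body n K \<and> centered n K} \<le> sqrt (real n) \<and>
      sqrt (real n) \<le> 1 * Inf {p_ratio n \<sigma> K | K. convex_body n K \<and> centered n K}"
    if n: "2 \<le> n" and \<sigma>: "rotation_invariant_prob n \<sigma>" for n \<sigma>
  proof -
    let ?P = "{p_ratio n \<sigma> K | K. convex_body n K \<and> centered n K}"
    have slab: "p_ratio n \<sigma> (slab n) \<in> ?P"
      using convex_body_slab centered_slab by blast
    have lower: "sqrt (real n) \<le> p" if "p \<in> ?P" for p
      using that p_ratio_ge[OF n \<sigma>] by auto
    have "Inf ?P \<le> p_ratio n \<sigma> (slab n)"
      using slab lower by (intro cInf_lower bdd_belowI)
    also have "\<dots> \<le> 36 / 5 * sqrt (real n)" by (rule p_ratio_slab[OF n \<sigma>])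
    finally have "5 / 36 * Inf ?P \<le> sqrt (real n)" by simp
    moreover have "sqrt (real n) \<le> Inf ?P"
      using slab lower by (intro cInf_greatest) auto
    ultimately show ?thesis by simp
  qed
  then show "\<exists>c1>0. \<exists>c2>0. \<forall>n\<ge>2. \<forall>\<sigma>. rotation_invariant_prob n \<sigma> \<longrightarrow>
      c1 * Inf {p_ratio n \<sigma> K | K. convex_body n K \<and> centered n K} \<le> sqrt (real n) \<and>
      sqrt (real n) \<le> c2 * Inf {p_ratio n \<sigma> K | K. convex_body n K \<and> centered n K}"
    by (intro exI[of _ "5 / 36"] exI[of _ 1] conjI allI impI) auto
qed

end
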